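(* Let $(M,p)$ be a projective manifold of dimension $n\ge2$. For every positive integer $k$, $q_k=p_k$, where $q_k$ is the curvature form of the projective tractor connection $$(q_k)_{a_1\cdots a_{2k}}:=\Omega_{a_1a_2}{}^{C_1}{}_{C_2}\Omega_{a_3a_4}{}^{C_2}{}_{C_3}\cdots\Omega_{a_{2k-1}a_{2k}}{}^{C_k}{}_{C_1}$$ and $p_k$ is the form $$(p_k)_{a_1\cdots a_{2k}}:=R_{a_1a_2}{}^{c_1}{}_{c_2}R_{a_3a_4}{}^{c_2}{}_{c_3}\cdots R_{a_{2k-1}a_{2k}}{}^{c_k}{}_{c_1},$$ in both of which $a_1,\dots,a_{2k}$ are skewed over, and where $R$ is the curvature of any scale connection in $p$.
   Context: A projective manifold $(M^n,p)$, $n\ge2$, is a smooth manifold with an equivalence class $p$ of torsion-free affine connections, where $\nabla\sim\widehat\nabla$ iff there is a 1-form $\Upsilon_a$ with $\widehat\nabla_aY^b=\nabla_aY^b+\Upsilon_aY^b+\Upsilon_cY^c\delta_a^b$. Curvature: $(\nabla_a\nabla_b-\nabla_b\nabla_a)v^c=R_{ab}{}^c{}_dv^d$, $\mathrm{Ric}_{ab}=R_{ca}{}^c{}_b$; the projective Schouten tensor $P_{ab}$ satisfies $(n-1)P_{ab}=\mathrm{Ric}_{ab}+\beta_{ab}$, $\beta_{ab}=-2P_{[ab]}$. A scale connection in $p$ is a connection $\nabla\in p$ with symmetric Schouten (equivalently symmetric Ricci) tensor. The form $p_k$ is independent of the scale connection chosen in $p$. Densities: $\mathcal{E}(1)$ is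 the positive $(2n+2)$-th root of $(\Lambda^nTM)^2$, $\mathcal{E}(w)$ its $w$-th power. The cotractor bundle is $\mathcal{E}_A=J^1\mathcal{E}(1)$, with exact sequence $0\to T^*M\otimes\mathcal{E}(1)\to\mathcal{E}_A\to\mathcal{E}(1)\to0$; each $\nabla\in p$ gives a splitting in which sections are written $(\mu_a\mid\sigma)$ and the (canonical) tractor connection is $\nabla_a(\mu_b\mid\sigma)=(\nabla_a\mu_b+P_{ab}\sigma\mid\nabla_a\sigma-\mu_a)$, independent of the choice of $\nabla\in p$. The tractor bundle $\mathcal{E}^A$ is the dual bundle with dual connection, and its curvature $\Omega_{ab}{}^C{}_D$ is defined by $(\nabla_a\nabla_b-\nabla_b\nabla_a)U^C=\Omega_{ab}{}^C{}_DU^D$ (with torsion-free coupling). *)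

theory Defs
  imports "HOL-Analysis.Analysis"
begin

section \<open>Smooth manifolds\<close>

text \<open>A chart is its domain together with its coordinate map; the map is only meaningful on the
  domain.\<close>

type_synonym ('m, 'n) chart = "'m set \<times> ('m \<Rightarrow> real^'n)"

abbreviation cdom :: "('m, 'n) chart \<Rightarrow> 'm set" where "cdom \<equiv> fst"
abbreviation coord :: "('m, 'n) chart \<Rightarrow> 'm \<Rightarrow> real^'n" where "coord \<equiv> snd"

definition param :: "('m, 'n) chart \<Rightarrow> real^'n \<Rightarrow> 'm" where
  "param c = inv_into (cdom c) (coord c)"

primrec Ck_on :: "nat \<Rightarrow> ('a::euclidean_space \<Rightarrow> 'b::real_normed_vector) \<Rightarrow> 'a set \<Rightarrow> bool" where
  "Ck_on 0 f S \<longleftrightarrow> continuous_on S f"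
| "Ck_on (Suc k) f S \<longleftrightarrow>
     f differentiable_on S \<and> (\<forall>v. Ck_on k (\<lambda>x. frechet_derivative f (at x) v) S)"

text \<open>Only used for open \<open>S\<close>.\<close>

definition smooth_on :: "'a::euclidean_space set \<Rightarrow> ('a \<Rightarrow> 'b::real_normed_vector) \<Rightarrow> bool" where
  "smooth_on S f \<longleftrightarrow> (\<forall>k. Ck_on k f S)"

definition smooth_atlas ::
  "('m::{t2_space,second_countable_topology}, 'n::finite) chart set \<Rightarrow> bool" where
  "smooth_atlas A \<longleftrightarrow>
     (\<Union>c\<in>A. cdom c) = UNIV \<and>
     (\<forall>c\<in>A. open (cdom c) \<and> open (coord c ` cdom c) \<and>
        homeomorphism (cdom c) (coord c ` cdom c) (coord c) (param c)) \<and>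
     (\<forall>c\<in>A. \<forall>d\<in>A. smooth_on (coord c ` (cdom c \<inter> cdom d)) (coord d \<circ> param c))"

definition smooth_in :: "('m, 'n::finite) chart \<Rightarrow> 'm set \<Rightarrow> ('m \<Rightarrow> 'b::real_normed_vector) \<Rightarrow> bool" where
  "smooth_in c U f \<longleftrightarrow> smooth_on (coord c ` (U \<inter> cdom c)) (f \<circ> param c)"

text \<open>\<open>pd c a f\<close> is the partial derivative of \<open>f\<close> along the \<open>a\<close>-th coordinate of the chart \<open>c\<close>.\<close>

definition pd :: "('m, 'n::finite) chart \<Rightarrow> 'n \<Rightarrow> ('m \<Rightarrow> 'b::real_normed_vector) \<Rightarrow> 'm \<Rightarrow> 'b" where
  "pd c a f x = frechet_derivative (f \<circ> param c) (at (coord c x)) (axis a 1)"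


section \<open>Vector bundles and their sections\<close>

text \<open>All bundles that occur are trivialised over every chart. A bundle is given by its transition
  matrices: \<open>E c d x\<close> takes the components over \<open>c\<close> of an element of the fibre at \<open>x\<close> to its
  components over \<open>d\<close>. A section over an open set is the family of its components.\<close>

type_synonym ('m, 'n, 'r) vbundle = "('m, 'n) chart \<Rightarrow> ('m, 'n) chart \<Rightarrow> 'm \<Rightarrow> real^'r^'r"

definition is_section :: "('m::topological_space, 'n::finite) chart set \<Rightarrow> ('m, 'n, 'r::finite) vbundle
    \<Rightarrow> 'm set \<Rightarrow> (('m, 'n) chart \<Rightarrow> 'm \<Rightarrow> real^'r) \<Rightarrow> bool" where
  "is_section A E U s \<longleftrightarrow>
     (\<forall>c\<in>A. smooth_in c U (s c)) \<and>
     (\<forall>c\<in>A. \<forall>d\<in>A. \<forall>x\<in>U \<inter> cdom c \<inter> cdom d. s d x = E c d x *v s c x)"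

definition is_smooth_function :: "('m, 'n::finite) chart set \<Rightarrow> 'm set \<Rightarrow> ('m \<Rightarrow> real) \<Rightarrow> bool" where
  "is_smooth_function A U f \<longleftrightarrow> (\<forall>c\<in>A. smooth_in c U f)"

text \<open>The Jacobian matrix of the coordinate change from \<open>c\<close> to \<open>d\<close>.\<close>

definition tangent :: "('m, 'n, 'n::finite) vbundle" where
  "tangent c d x = (\<chi> b a. pd c a (\<lambda>z. coord d z $ b) x)"

definition dual :: "('m, 'n::finite, 'r::finite) vbundle \<Rightarrow> ('m, 'n, 'r) vbundle" where
  "dual E c d x = transpose (matrix_inv (E c d x))"

abbreviation cotangent :: "('m, 'n, 'n::finite) vbundle" where
  "cotangent \<equiv> dual tangent"

text \<open>\<open>\<E>(1)\<close>: the transition function of \<open>(\<Lambda>\<^sup>n TM)\<^sup>2\<close> is \<open>(det (tangent c d x))\<^sup>2\<close>, and \<open>\<E>(1)\<close> is its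
  positive \<open>(2n+2)\<close>-th root.\<close>

definition density_transition :: "('m, 'n::finite) chart \<Rightarrow> ('m, 'n) chart \<Rightarrow> 'm \<Rightarrow> real" where
  "density_transition c d x = root (2 * CARD('n) + 2) ((det (tangent c d x))\<^sup>2)"

definition is_density_section :: "('m::topological_space, 'n::finite) chart set \<Rightarrow> 'm set
    \<Rightarrow> (('m, 'n) chart \<Rightarrow> 'm \<Rightarrow> real) \<Rightarrow> bool" where
  "is_density_section A U \<sigma> \<longleftrightarrow>
     (\<forall>c\<in>A. smooth_in c U (\<sigma> c)) \<and>
     (\<forall>c\<in>A. \<forall>d\<in>A. \<forall>x\<in>U \<inter> cdom c \<inter> cdom d. \<sigma> d x = density_transition c d x * \<sigma> c x)"

text \<open>The first jet of \<open>\<sigma>\<close> at \<open>x\<close> in the coordinates of \<open>c\<close>: the component \<open>None\<close> is the value and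
  \<open>Some a\<close> is the \<open>a\<close>-th partial derivative.\<close>

definition jet1 :: "('m, 'n::finite) chart \<Rightarrow> ('m \<Rightarrow> real) \<Rightarrow> 'm \<Rightarrow> real^('n option)" where
  "jet1 c \<sigma> x = (\<chi> i. case i of None \<Rightarrow> \<sigma> x | Some a \<Rightarrow> pd c a \<sigma> x)"

text \<open>The cotractor bundle \<open>J\<^sup>1\<E>(1)\<close>. Its transition matrices express the jet of
  \<open>\<sigma> d = density_transition c d * \<sigma> c\<close> in the coordinates of \<open>d\<close> by the jet of \<open>\<sigma> c\<close> in those of \<open>c\<close>;
  see \<open>jet1_transition\<close> below.\<close>

definition cotractor :: "('m, 'n::finite, 'n option) vbundle" where
  "cotractor c d x = (\<chi> i j. case i of
       None \<Rightarrow> (case j of None \<Rightarrow> density_transition c d x | Some b \<Rightarrow> 0)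
     | Some a \<Rightarrow> (case j of
           None \<Rightarrow> pd d a (density_transition c d) x
         | Some b \<Rightarrow> density_transition c d x * tangent d c x $ b $ a))"

context
  fixes A :: "('m::{t2_space,second_countable_topology}, 'n::finite) chart set"
  assumes atlas: "smooth_atlas A"
begin

lemma param_coord: "c \<in> A \<Longrightarrow> x \<in> cdom c \<Longrightarrow> param c (coord c x) = x"
  using atlas by (auto simp: smooth_atlas_def homeomorphism_def)

lemma open_coord_image:
  assumes "c \<in> A" "open U"
  shows "open (coord c ` (U \<inter> cdom c))"
proof -
  have h: "homeomorphism (cdom c) (coord c ` cdom c) (coord c) (param c)"
    and o: "open (coord c ` cdom c)"
    using atlas assms by (auto simp: smooth_atlas_def)
  have "openin (top_of_set (coord c ` cdom c)) (coord c ` (cdom c \<inter> U))"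
    by (rule homeomorphism_imp_open_map[OF h]) (use assms in \<open>auto simp: openin_open\<close>)
  then show ?thesis using o by (metis inf_commute openin_open_eq)
qed

lemma open_overlap: "c \<in> A \<Longrightarrow> d \<in> A \<Longrightarrow> open (coord c ` (cdom c \<inter> cdom d))"
  using open_coord_image[of c "cdom d"] atlas by (simp add: smooth_atlas_def inf_commute)

lemma transition_Ck:
  assumes "c \<in> A" "d \<in> A"
  shows "Ck_on k (coord d \<circ> param c) (coord c ` (cdom c \<inter> cdom d))"
  using assms atlas by (auto simp: smooth_atlas_def smooth_on_def)

lemma transition_differentiable:
  assumes "c \<in> A" "d \<in> A" "x \<in> cdom c \<inter> cdom d"
  shows "(coord d \<circ> param c) differentiable (at (coord c x))"
  using transition_Ck[OF assms(1,2), of 1] open_overlap[OF assms(1,2)] assms(3)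
  by (simp add: differentiable_on_eq_differentiable_at)

text \<open>The chain rule for a change of coordinates.\<close>

lemma pd_change_chart:
  fixes f :: "'m \<Rightarrow> real"
  assumes c: "c \<in> A" and d: "d \<in> A" and x: "x \<in> cdom c \<inter> cdom d"
    and f: "(f \<circ> param c) differentiable (at (coord c x))"
  shows "(f \<circ> param d) differentiable (at (coord d x))"
    and "pd d a f x = (\<Sum>b\<in>UNIV. tangent d c x $ b $ a * pd c b f x)"
proof -
  let ?t = "coord c \<circ> param d"
  let ?W = "coord d ` (cdom d \<inter> cdom c)"
  have W: "open ?W" "coord d x \<in> ?W" using open_overlap[OF d c] x by auto
  define T where "T = frechet_derivative ?t (at (coord d x))"
  define F where "F = frechet_derivative (f \<circ> param c) (at (coord c x))"
  have t: "(?t has_derivative T) (at (coord d x))"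
    using transition_differentiable[OF d c] x unfolding T_def frechet_derivative_works[symmetric] by auto
  have tx: "?t (coord d x) = coord c x" using x param_coord[OF d] by simp
  have F: "(f \<circ> param c has_derivative F) (at (?t (coord d x)))"
    using f unfolding F_def tx frechet_derivative_works[symmetric] .
  have "((f \<circ> param c) \<circ> ?t has_derivative F \<circ> T) (at (coord d x))"
    by (rule diff_chain_at[OF t F])
  then have G: "(f \<circ> param d has_derivative F \<circ> T) (at (coord d x))"
    by (rule has_derivative_transform_within_open[OF _ W])
       (auto simp: param_coord[OF c] param_coord[OF d])
  then show "(f \<circ> param d) differentiable (at (coord d x))" by (rule differentiableI)
  have ta: "tangent d c x $ b $ a = T (axis a 1) $ b" for b
  proof -
    have "((\<lambda>y. ?t y $ b) has_derivative (\<lambda>v. T v $ b)) (at (coord d x))"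
      by (rule bounded_linear.has_derivative[OF bounded_linear_vec_nth t])
    then have "frechet_derivative (\<lambda>y. ?t y $ b) (at (coord d x)) = (\<lambda>v. T v $ b)"
      by (rule frechet_derivative_at[symmetric])
    then show ?thesis by (simp add: tangent_def pd_def o_def)
  qed
  have lF: "linear F" using F by (rule has_derivative_linear)
  have "pd d a f x = F (T (axis a 1))"
    using frechet_derivative_at[OF G, symmetric] by (simp add: pd_def)
  also have "\<dots> = F (\<Sum>b\<in>UNIV. T (axis a 1) $ b *\<^sub>R axis b 1)"
    by (simp add: basis_expansion scalar_mult_eq_scaleR[symmetric])
  also have "\<dots> = (\<Sum>b\<in>UNIV. T (axis a 1) $ b * F (axis b 1))"
    using lF by (simp add: linear_sum linear_scale)
  also have "\<dots> = (\<Sum>b\<in>UNIV. tangent d c x $ b $ a * pd c b f x)"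
    by (simp add: ta) (simp add: pd_def F_def)
  finally show "pd d a f x = (\<Sum>b\<in>UNIV. tangent d c x $ b $ a * pd c b f x)" .
qed

lemma tangent_inverse:
  assumes c: "c \<in> A" and d: "d \<in> A" and x: "x \<in> cdom c \<inter> cdom d"
  shows "tangent d c x ** tangent c d x = mat 1"
proof -
  have o: "open (coord c ` cdom c)" "coord c x \<in> coord c ` cdom c"
    using atlas c x by (auto simp: smooth_atlas_def)
  have D: "((\<lambda>z. coord c z $ b) \<circ> param c has_derivative (\<lambda>v. v $ b)) (at (coord c x))" for b
    by (rule has_derivative_transform_within_open[OF
          bounded_linear.has_derivative[OF bounded_linear_vec_nth has_derivative_ident] o])
       (auto simp: param_coord[OF c])
  have e: "pd c a (\<lambda>z. coord c z $ b) x = (if a = b then 1 else 0)" for a b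
    using frechet_derivative_at[OF D[of b], symmetric] by (simp add: pd_def axis_def)
  have df: "((\<lambda>z. coord c z $ b) \<circ> param d) differentiable (at (coord d x))" for b
    using pd_change_chart(1)[OF c d x differentiableI[OF D[of b]]] .
  have "(\<Sum>k\<in>UNIV. tangent c d x $ k $ a * pd d k (\<lambda>z. coord c z $ b) x)
      = pd c a (\<lambda>z. coord c z $ b) x" for a b
    by (rule pd_change_chart(2)[OF d c _ df, symmetric]) (use x in auto)
  then have "(\<Sum>k\<in>UNIV. tangent d c x $ b $ k * tangent c d x $ k $ a) = (if b = a then 1 else 0)" for a b
    unfolding e by (simp add: tangent_def mult.commute eq_commute)
  then show ?thesis
    unfolding vec_eq_iff matrix_matrix_mult_def mat_def by simp
qed

lemma density_differentiable:
  assumes c: "c \<in> A" and d: "d \<in> A" and x: "x \<in> cdom c \<inter> cdom d"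
  shows "(density_transition c d \<circ> param d) differentiable (at (coord d x))"
proof (rule pd_change_chart(1)[OF c d x])
  let ?t = "coord d \<circ> param c"
  let ?W = "coord c ` (cdom c \<inter> cdom d)"
  let ?J = "\<lambda>y. tangent c d (param c y)"
  have W: "open ?W" "coord c x \<in> ?W" using open_overlap[OF c d] x by auto
  have J: "(\<lambda>y. ?J y $ b $ a) differentiable (at (coord c x))" for a b
  proof -
    have "Ck_on 1 (\<lambda>y. frechet_derivative ?t (at y) (axis a 1)) ?W"
      using transition_Ck[OF c d, of "Suc (Suc 0)"] unfolding One_nat_def Ck_on.simps by blast
    then have "(\<lambda>y. frechet_derivative ?t (at y) (axis a 1)) differentiable (at (coord c x))"
      using W(1) x by (auto simp add: differentiable_on_eq_differentiable_at)
    then obtain G where "((\<lambda>y. frechet_derivative ?t (at y) (axis a 1)) has_derivative G) (at (coord c x))"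
      by (auto simp: differentiable_def)
    then have "((\<lambda>y. frechet_derivative ?t (at y) (axis a 1) $ b) has_derivative (\<lambda>v. G v $ b)) (at (coord c x))"
      by (rule bounded_linear.has_derivative[OF bounded_linear_vec_nth])
    then have "((\<lambda>y. ?J y $ b $ a) has_derivative (\<lambda>v. G v $ b)) (at (coord c x))"
    proof (rule has_derivative_transform_within_open[OF _ W])
      fix y assume "y \<in> ?W"
      then obtain z where z: "z \<in> cdom c \<inter> cdom d" "y = coord c z" by auto
      have "(?t has_derivative frechet_derivative ?t (at y)) (at y)"
        using transition_differentiable[OF c d z(1)] unfolding z(2) frechet_derivative_works[symmetric] .
      then have "((\<lambda>y. ?t y $ b) has_derivative (\<lambda>v. frechet_derivative ?t (at y) v $ b)) (at y)"
        by (rule bounded_linear.has_derivative[OF bounded_linear_vec_nth])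
      then have "frechet_derivative (\<lambda>y. ?t y $ b) (at y) = (\<lambda>v. frechet_derivative ?t (at y) v $ b)"
        by (rule frechet_derivative_at[symmetric])
      then show "frechet_derivative ?t (at y) (axis a 1) $ b = ?J y $ b $ a"
        using z param_coord[OF c] by (simp add: tangent_def pd_def o_def)
    qed
    then show ?thesis by (rule differentiableI)
  qed
  have det: "(\<lambda>y. det (?J y)) differentiable (at (coord c x))"
  proof -
    have G: "((\<lambda>y. ?J y $ b $ a) has_derivative frechet_derivative (\<lambda>y. ?J y $ b $ a) (at (coord c x)))
        (at (coord c x))" for a b
      using J[of b a] unfolding frechet_derivative_works .
    show ?thesis unfolding det_def
      by (rule differentiableI, rule has_derivative_sum, rule has_derivative_mult_right,
          rule has_derivative_prod, rule G)
  qed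
  have px: "param c (coord c x) = x" using param_coord[OF c] x by simp
  have "det (tangent d c x) * det (tangent c d x) = 1"
    using tangent_inverse[OF c d x] by (metis det_I det_mul)
  then have nz: "(det (?J (coord c x)))\<^sup>2 > 0" by (auto simp: px)
  have "(\<lambda>y. (det (?J y))\<^sup>2) differentiable (at (coord c x))"
    using det by simp
  then obtain G where G: "((\<lambda>y. (det (?J y))\<^sup>2) has_derivative G) (at (coord c x))"
    by (auto simp: differentiable_def)
  have "DERIV (root (2 * CARD('n) + 2)) ((det (?J (coord c x)))\<^sup>2) :>
      inverse (real (2 * CARD('n) + 2) * root (2 * CARD('n) + 2) ((det (?J (coord c x)))\<^sup>2) ^ (2 * CARD('n) + 2 - Suc 0))"
    by (rule DERIV_real_root) (use nz in auto)
  from DERIV_compose_FDERIV[OF this G]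
  show "(density_transition c d \<circ> param c) differentiable (at (coord c x))"
    by (auto simp: density_transition_def o_def intro: differentiableI)
qed

lemma jet1_transition:
  assumes U: "open U" and \<sigma>: "is_density_section A U \<sigma>"
    and c: "c \<in> A" and d: "d \<in> A" and x: "x \<in> U \<inter> cdom c \<inter> cdom d"
  shows "jet1 d (\<sigma> d) x = cotractor c d x *v jet1 c (\<sigma> c) x"
proof -
  have x': "x \<in> cdom c \<inter> cdom d" using x by auto
  have s: "\<sigma> d z = density_transition c d z * \<sigma> c z" if "z \<in> U \<inter> cdom c \<inter> cdom d" for z
    using \<sigma> c d that unfolding is_density_section_def by blast
  have "Ck_on 1 (\<sigma> c \<circ> param c) (coord c ` (U \<inter> cdom c))"
    using \<sigma> c unfolding is_density_section_def smooth_in_def smooth_on_def by blast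
  then have sc: "(\<sigma> c \<circ> param c) differentiable (at (coord c x))"
    using open_coord_image[OF c U] x by (simp add: differentiable_on_eq_differentiable_at)
  define S where "S = frechet_derivative (\<sigma> c \<circ> param d) (at (coord d x))"
  define H where "H = frechet_derivative (density_transition c d \<circ> param d) (at (coord d x))"
  have S: "(\<sigma> c \<circ> param d has_derivative S) (at (coord d x))"
    using pd_change_chart(1)[OF c d x' sc] unfolding S_def frechet_derivative_works[symmetric] .
  have H: "(density_transition c d \<circ> param d has_derivative H) (at (coord d x))"
    using density_differentiable[OF c d x'] unfolding H_def frechet_derivative_works[symmetric] .
  have px: "param d (coord d x) = x" using param_coord[OF d] x by simp
  let ?W = "coord d ` ((U \<inter> cdom c) \<inter> cdom d)"
  have W: "open ?W" "coord d x \<in> ?W"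
    using open_coord_image[OF d, of "U \<inter> cdom c"] U c atlas x by (auto simp: smooth_atlas_def)
  have "((\<lambda>y. (density_transition c d \<circ> param d) y * (\<sigma> c \<circ> param d) y) has_derivative
      (\<lambda>v. density_transition c d x * S v + H v * \<sigma> c x)) (at (coord d x))"
    using has_derivative_mult[OF H S] by (simp add: px)
  then have "(\<sigma> d \<circ> param d has_derivative (\<lambda>v. density_transition c d x * S v + H v * \<sigma> c x)) (at (coord d x))"
    by (rule has_derivative_transform_within_open[OF _ W]) (auto simp: param_coord[OF d] s)
  from frechet_derivative_at[OF this, symmetric]
  have "pd d a (\<sigma> d) x = density_transition c d x * pd d a (\<sigma> c) x + pd d a (density_transition c d) x * \<sigma> c x" for a
    by (simp add: pd_def S_def H_def)
  then have p: "pd d a (\<sigma> d) x = pd d a (density_transition c d) x * \<sigma> c x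
      + (\<Sum>b\<in>UNIV. density_transition c d x * tangent d c x $ b $ a * pd c b (\<sigma> c) x)" for a
    using pd_change_chart(2)[OF c d x' sc, of a] by (simp add: sum_distrib_left mult.assoc)
  show ?thesis
    unfolding vec_eq_iff
  proof
    fix i :: "'n option"
    show "jet1 d (\<sigma> d) x $ i = (cotractor c d x *v jet1 c (\<sigma> c) x) $ i"
      using s[OF x] p
      by (cases i) (simp_all add: jet1_def cotractor_def matrix_vector_mult_def UNIV_option_conv
          sum.reindex)
  qed
qed

end

abbreviation tractor :: "('m, 'n::finite, 'n option) vbundle" where
  "tractor \<equiv> dual cotractor"


section \<open>Connections\<close>

text \<open>A covariant derivative in local trivialisations: if \<open>u\<close> has the components over \<open>c\<close> of a
  section \<open>s\<close>, then \<open>D c u x a\<close> has the components over \<open>c\<close> of \<open>\<nabla>\<^sub>a s\<close> at \<open>x\<close>, where \<open>a\<close> is a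
  coordinate direction of \<open>c\<close>.\<close>

type_synonym ('m, 'n, 'r) cov = "('m, 'n) chart \<Rightarrow> ('m \<Rightarrow> real^'r) \<Rightarrow> 'm \<Rightarrow> 'n \<Rightarrow> real^'r"

text \<open>\<open>D\<close> maps sections of \<open>E\<close> to sections of \<open>T\<^sup>*M \<otimes> E\<close>, over every open set, and it is local,
  additive and satisfies the Leibniz rule.\<close>

definition is_connection :: "('m::topological_space, 'n::finite) chart set
    \<Rightarrow> ('m, 'n, 'r::finite) vbundle \<Rightarrow> ('m, 'n, 'r) cov \<Rightarrow> bool" where
  "is_connection A E D \<longleftrightarrow>
     (\<forall>U s. open U \<and> is_section A E U s \<longrightarrow>
        (\<forall>c\<in>A. \<forall>a. smooth_in c U (\<lambda>x. D c (s c) x a)) \<and>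
        (\<forall>c\<in>A. \<forall>d\<in>A. \<forall>x\<in>U \<inter> cdom c \<inter> cdom d. \<forall>a.
           D d (s d) x a = (\<Sum>b\<in>UNIV. cotangent c d x $ a $ b *\<^sub>R (E c d x *v D c (s c) x b)))) \<and>
     (\<forall>U s t. open U \<and> is_section A E U s \<and> is_section A E U t \<and>
        (\<forall>c\<in>A. \<forall>x\<in>U \<inter> cdom c. s c x = t c x) \<longrightarrow>
        (\<forall>c\<in>A. \<forall>x\<in>U \<inter> cdom c. \<forall>a. D c (s c) x a = D c (t c) x a)) \<and>
     (\<forall>U s t. open U \<and> is_section A E U s \<and> is_section A E U t \<longrightarrow>
        (\<forall>c\<in>A. \<forall>x\<in>U \<inter> cdom c. \<forall>a.
           D c (\<lambda>z. s c z + t c z) x a = D c (s c) x a + D c (t c) x a)) \<and>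
     (\<forall>U s f. open U \<and> is_section A E U s \<and> is_smooth_function A U f \<longrightarrow>
        (\<forall>c\<in>A. \<forall>x\<in>U \<inter> cdom c. \<forall>a.
           D c (\<lambda>z. f z *\<^sub>R s c z) x a = pd c a f x *\<^sub>R s c x + f x *\<^sub>R D c (s c) x a))"

text \<open>\<open>christoffel N c x a b $ d\<close> is \<open>\<Gamma>\<^sub>a\<^sub>b\<^sup>d\<close>, i.e. \<open>\<nabla>\<^sub>a \<partial>\<^sub>b = \<Gamma>\<^sub>a\<^sub>b\<^sup>d \<partial>\<^sub>d\<close> for the coordinate frame of \<open>c\<close>.\<close>

definition christoffel :: "('m, 'n::finite, 'n) cov \<Rightarrow> ('m, 'n) chart \<Rightarrow> 'm \<Rightarrow> 'n \<Rightarrow> 'n \<Rightarrow> real^'n" where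
  "christoffel N c x a b = N c (\<lambda>_. axis b 1) x a"

definition torsion_free_connections ::
  "('m::topological_space, 'n::finite) chart set \<Rightarrow> ('m, 'n, 'n) cov set" where
  "torsion_free_connections A = {N. is_connection A tangent N \<and>
     (\<forall>c\<in>A. \<forall>x\<in>cdom c. \<forall>a b. christoffel N c x a b = christoffel N c x b a)}"

text \<open>The connection on the dual bundle: \<open>(\<nabla>\<^sub>a U)\<^sup>C\<close> is \<open>\<nabla>\<^sub>a U\<close> paired with the \<open>C\<close>-th element
  \<open>e\<^sup>C\<close> of the local frame of \<open>E\<close>, hence \<open>\<partial>\<^sub>a \<langle>U, e\<^sup>C\<rangle> - \<langle>U, \<nabla>\<^sub>a e\<^sup>C\<rangle>\<close>.\<close>

definition dual_cov :: "('m, 'n::finite, 'r::finite) cov \<Rightarrow> ('m, 'n, 'r) cov" where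
  "dual_cov D c u x a = (\<chi> C. pd c a (\<lambda>z. u z $ C) x - u x \<bullet> D c (\<lambda>_. axis C 1) x a)"

text \<open>\<open>\<nabla>\<^sub>a \<nabla>\<^sub>b s\<close>, where \<open>\<nabla>\<^sub>b s\<close> is differentiated with the coupling of \<open>D\<close> to the affine
  connection \<open>N\<close>, which acts on the index \<open>b\<close>.\<close>

definition second_cov :: "('m, 'n::finite, 'n) cov \<Rightarrow> ('m, 'n, 'r::finite) cov
    \<Rightarrow> ('m, 'n) chart \<Rightarrow> ('m \<Rightarrow> real^'r) \<Rightarrow> 'm \<Rightarrow> 'n \<Rightarrow> 'n \<Rightarrow> real^'r" where
  "second_cov N D c u x a b =
     D c (\<lambda>z. D c u z b) x a - (\<Sum>e\<in>UNIV. christoffel N c x a b $ e *\<^sub>R D c u x e)"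

text \<open>\<open>curvature A E N D c x a b $ C $ D\<close> has the upper index \<open>C\<close> and the lower index \<open>D\<close>.\<close>

definition curvature :: "('m::topological_space, 'n::finite) chart set \<Rightarrow> ('m, 'n, 'r::finite) vbundle
    \<Rightarrow> ('m, 'n, 'n) cov \<Rightarrow> ('m, 'n, 'r) cov
    \<Rightarrow> ('m, 'n) chart \<Rightarrow> 'm \<Rightarrow> 'n \<Rightarrow> 'n \<Rightarrow> real^'r^'r" where
  "curvature A E N D c x a b = (THE R. \<forall>U s. open U \<and> x \<in> U \<and> is_section A E U s \<longrightarrow>
     second_cov N D c (s c) x a b - second_cov N D c (s c) x b a = R *v s c x)"


section \<open>Projective structures\<close>

definition projective_rel :: "('m::topological_space, 'n::finite) chart set
    \<Rightarrow> (('m, 'n, 'n) cov \<times> ('m, 'n, 'n) cov) set" where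
  "projective_rel A = {(N, N'). N \<in> torsion_free_connections A \<and> N' \<in> torsion_free_connections A \<and>
     (\<exists>\<Upsilon>. is_section A cotangent UNIV \<Upsilon> \<and>
       (\<forall>U Y. open U \<and> is_section A tangent U Y \<longrightarrow>
         (\<forall>c\<in>A. \<forall>x\<in>U \<inter> cdom c. \<forall>a b.
            N' c (Y c) x a $ b = N c (Y c) x a $ b + \<Upsilon> c x $ a * Y c x $ b
              + (\<Sum>e\<in>UNIV. \<Upsilon> c x $ e * Y c x $ e) * (if a = b then 1 else 0))))}"

definition projective_structure :: "('m::topological_space, 'n::finite) chart set
    \<Rightarrow> ('m, 'n, 'n) cov set \<Rightarrow> bool" where
  "projective_structure A p \<longleftrightarrow> p \<in> torsion_free_connections A // projective_rel A"

abbreviation affine_curvature :: "('m::topological_space, 'n::finite) chart set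
    \<Rightarrow> ('m, 'n, 'n) cov \<Rightarrow> ('m, 'n) chart \<Rightarrow> 'm \<Rightarrow> 'n \<Rightarrow> 'n \<Rightarrow> real^'n^'n" where
  "affine_curvature A N \<equiv> curvature A tangent N N"

definition ricci :: "('m::topological_space, 'n::finite) chart set
    \<Rightarrow> ('m, 'n, 'n) cov \<Rightarrow> ('m, 'n) chart \<Rightarrow> 'm \<Rightarrow> 'n \<Rightarrow> 'n \<Rightarrow> real" where
  "ricci A N c x a b = (\<Sum>i\<in>UNIV. affine_curvature A N c x i a $ i $ b)"

definition schouten_beta :: "('n \<Rightarrow> 'n \<Rightarrow> real) \<Rightarrow> 'n \<Rightarrow> 'n \<Rightarrow> real" where
  "schouten_beta P a b = - 2 * ((P a b - P b a) / 2)"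

definition schouten :: "('m::topological_space, 'n::finite) chart set
    \<Rightarrow> ('m, 'n, 'n) cov \<Rightarrow> ('m, 'n) chart \<Rightarrow> 'm \<Rightarrow> 'n \<Rightarrow> 'n \<Rightarrow> real" where
  "schouten A N c x = (THE P. \<forall>a b.
     (real CARD('n) - 1) * P a b = ricci A N c x a b + schouten_beta P a b)"

lemma schouten_eq:
  fixes N :: "('m::topological_space, 'n::finite) chart \<Rightarrow> ('m \<Rightarrow> real^'n) \<Rightarrow> 'm \<Rightarrow> 'n \<Rightarrow> real^'n"
  assumes "CARD('n) \<ge> 2"
  shows "(real CARD('n) - 1) * schouten A N c x a b =
           ricci A N c x a b + schouten_beta (schouten A N c x) a b"
proof -
  let ?n = "real CARD('n)"
  let ?R = "ricci A N c x"
  let ?P = "\<lambda>a b. (?n * ?R a b + ?R b a) / (?n\<^sup>2 - 1)"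
  let ?Q = "\<lambda>P. \<forall>a b. (?n - 1) * P a b = ?R a b + schouten_beta P a b"
  have n: "?n \<ge> 2" using assms by simp
  have f: "?n\<^sup>2 - 1 = (?n - 1) * (?n + 1)" by (simp add: power2_eq_square algebra_simps)
  have n1: "?n - 1 \<noteq> 0" "?n + 1 \<noteq> 0" "?n\<^sup>2 - 1 \<noteq> 0"
    using n unfolding f by auto
  have beta: "schouten_beta P a b = P b a - P a b" for P :: "'n \<Rightarrow> 'n \<Rightarrow> real" and a b
    by (simp add: schouten_beta_def)
  have ex: "?Q ?P"
  proof (intro allI)
    fix a b
    have "schouten_beta ?P a b = ?P b a - ?P a b" by (rule beta)
    also have "\<dots> = ((?n - 1) * (?R b a - ?R a b)) / (?n\<^sup>2 - 1)"
      unfolding diff_divide_distrib[symmetric] by (simp add: algebra_simps)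
    also have "\<dots> = (?R b a - ?R a b) / (?n + 1)"
      using n1 unfolding f by simp
    finally have 1: "schouten_beta ?P a b = (?R b a - ?R a b) / (?n + 1)" .
    have 2: "(?n - 1) * ?P a b = (?n * ?R a b + ?R b a) / (?n + 1)"
      using n1 unfolding f by simp
    have 3: "(?n * ?R a b + ?R b a) / (?n + 1) = ?R a b + (?R b a - ?R a b) / (?n + 1)"
      using n1(2) by (simp add: field_simps)
    show "(?n - 1) * ?P a b = ?R a b + schouten_beta ?P a b"
      unfolding 1 2 3 ..
  qed
  have un: "P = ?P" if "?Q P" for P
  proof (intro ext)
    fix a b
    have 1: "(?n - 1) * P a b = ?R a b - (P a b - P b a)"
      using that[rule_format, of a b] by (simp add: schouten_beta_def)
    have 2: "(?n - 1) * P b a = ?R b a - (P b a - P a b)"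
      using that[rule_format, of b a] by (simp add: schouten_beta_def)
    have "?n * P a b = ?R a b + P b a" "?n * P b a = ?R b a + P a b"
      using 1 2 by (simp_all add: algebra_simps)
    then have "?n * (?n * P a b) = ?n * ?R a b + (?R b a + P a b)"
      by (simp add: algebra_simps)
    then have "(?n\<^sup>2 - 1) * P a b = ?n * ?R a b + ?R b a"
      by (simp add: algebra_simps power2_eq_square)
    then show "P a b = ?P a b" using n1(3) by (simp add: field_simps)
  qed
  have "?Q (schouten A N c x)"
    unfolding schouten_def by (rule theI[of ?Q, OF ex un])
  then show ?thesis by blast
qed

definition scale_connection :: "('m::topological_space, 'n::finite) chart set
    \<Rightarrow> ('m, 'n, 'n) cov \<Rightarrow> bool" where
  "scale_connection A N \<longleftrightarrow> N \<in> torsion_free_connections A \<and>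
     (\<forall>c\<in>A. \<forall>x\<in>cdom c. \<forall>a b. schouten A N c x a b = schouten A N c x b a)"


section \<open>The tractor connection\<close>

text \<open>In the frame \<open>\<partial>\<^sub>1 \<and> \<dots> \<and> \<partial>\<^sub>n\<close> the connection on \<open>\<Lambda>\<^sup>n TM\<close> induced by \<open>N\<close> has the connection form
  \<open>\<Gamma>\<^sub>a\<^sub>i\<^sup>i\<close>; as \<open>\<E>(1)\<close> is the \<open>(2n+2)\<close>-th root of the square of this bundle, its connection form
  is \<open>\<Gamma>\<^sub>a\<^sub>i\<^sup>i / (n+1)\<close>.\<close>

definition density_form :: "('m, 'n::finite, 'n) cov \<Rightarrow> ('m, 'n) chart \<Rightarrow> 'm \<Rightarrow> 'n \<Rightarrow> real" where
  "density_form N c x a = 2 * (\<Sum>i\<in>UNIV. christoffel N c x a i $ i) / (2 * real CARD('n) + 2)"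

definition density_cov ::
  "('m, 'n::finite, 'n) cov \<Rightarrow> ('m, 'n) chart \<Rightarrow> ('m \<Rightarrow> real) \<Rightarrow> 'm \<Rightarrow> 'n \<Rightarrow> real" where
  "density_cov N c \<sigma> x a = pd c a \<sigma> x + density_form N c x a * \<sigma> x"

text \<open>\<open>\<nabla>\<^sub>a \<mu>\<^sub>b\<close> for a section \<open>\<mu>\<close> of \<open>T\<^sup>*M \<otimes> \<E>(1)\<close>.\<close>

definition weighted_covector_cov ::
  "('m, 'n::finite, 'n) cov \<Rightarrow> ('m, 'n) chart \<Rightarrow> ('m \<Rightarrow> real^'n) \<Rightarrow> 'm \<Rightarrow> 'n \<Rightarrow> 'n \<Rightarrow> real" where
  "weighted_covector_cov N c \<mu> x a b = dual_cov N c \<mu> x a $ b + density_form N c x a * \<mu> x $ b"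

text \<open>The splitting of \<open>J\<^sup>1\<E>(1)\<close> determined by \<open>N\<close> takes the jet of \<open>\<sigma>\<close> to \<open>(\<nabla>\<^sub>a \<sigma> | \<sigma>)\<close>.\<close>

definition split_cotractor ::
  "('m, 'n::finite, 'n) cov \<Rightarrow> ('m, 'n) chart \<Rightarrow> 'm \<Rightarrow> real^('n option) \<Rightarrow> (real^'n) \<times> real" where
  "split_cotractor N c x v = ((\<chi> a. v $ Some a + density_form N c x a * v $ None), v $ None)"

definition unsplit_cotractor ::
  "('m, 'n::finite, 'n) cov \<Rightarrow> ('m, 'n) chart \<Rightarrow> 'm \<Rightarrow> (real^'n) \<times> real \<Rightarrow> real^('n option)" where
  "unsplit_cotractor N c x = (\<lambda>(\<mu>, \<sigma>).
     \<chi> i. case i of None \<Rightarrow> \<sigma> | Some a \<Rightarrow> \<mu> $ a - density_form N c x a * \<sigma>)"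

definition cotractor_cov :: "('m::topological_space, 'n::finite) chart set
    \<Rightarrow> ('m, 'n, 'n) cov \<Rightarrow> ('m, 'n, 'n option) cov" where
  "cotractor_cov A N c v x a =
     (let \<mu> = (\<lambda>z. fst (split_cotractor N c z (v z)));
          \<sigma> = (\<lambda>z. snd (split_cotractor N c z (v z)))
      in unsplit_cotractor N c x
           (\<chi> b. weighted_covector_cov N c \<mu> x a b + schouten A N c x a b * \<sigma> x,
            density_cov N c \<sigma> x a - \<mu> x $ a))"

definition tractor_cov :: "('m::topological_space, 'n::finite) chart set
    \<Rightarrow> ('m, 'n, 'n) cov \<Rightarrow> ('m, 'n, 'n option) cov" where
  "tractor_cov A N = dual_cov (cotractor_cov A N)"

abbreviation tractor_curvature :: "('m::topological_space, 'n::finite) chart set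
    \<Rightarrow> ('m, 'n, 'n) cov \<Rightarrow> ('m, 'n) chart \<Rightarrow> 'm \<Rightarrow> 'n \<Rightarrow> 'n \<Rightarrow> real^('n option)^('n option)" where
  "tractor_curvature A N \<equiv> curvature A tractor N (tractor_cov A N)"


section \<open>The curvature forms\<close>

text \<open>The component with indices \<open>a 0, \<dots>, a (2 * k - 1)\<close> of the skew part of the cyclic contraction of
  \<open>k\<close> copies of \<open>F\<close>, i.e. of the trace of the matrix product \<open>F (a 0) (a 1) ** F (a 2) (a 3) ** \<dots>\<close>.\<close>

definition skew_trace :: "nat \<Rightarrow> ('n \<Rightarrow> 'n \<Rightarrow> real^'r::finite^'r) \<Rightarrow> (nat \<Rightarrow> 'n) \<Rightarrow> real" where
  "skew_trace k F a = (\<Sum>\<pi> | \<pi> permutes {..<2 * k}. of_int (sign \<pi>) *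
     trace (foldr (\<lambda>i M. F (a (\<pi> (2 * i))) (a (\<pi> (2 * i + 1))) ** M) [0..<k] (mat 1)))
     / fact (2 * k)"

definition q_form :: "('m::topological_space, 'n::finite) chart set \<Rightarrow> ('m, 'n, 'n) cov \<Rightarrow> nat
    \<Rightarrow> ('m, 'n) chart \<Rightarrow> 'm \<Rightarrow> (nat \<Rightarrow> 'n) \<Rightarrow> real" where
  "q_form A N k c x = skew_trace k (tractor_curvature A N c x)"

definition p_form :: "('m::topological_space, 'n::finite) chart set \<Rightarrow> ('m, 'n, 'n) cov \<Rightarrow> nat
    \<Rightarrow> ('m, 'n) chart \<Rightarrow> 'm \<Rightarrow> (nat \<Rightarrow> 'n) \<Rightarrow> real" where
  "p_form A N k c x = skew_trace k (affine_curvature A N c x)"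

end

theory Submission
  imports Defs
begin

text \<open>In a chart, let \<open>\<omega>\<^sub>a = \<Gamma>\<^sub>a\<^sub>i\<^sup>i / (n + 1)\<close> and let \<open>\<Pi>\<^sub>a\<^sub>b\<^sup>d = \<Gamma>\<^sub>a\<^sub>b\<^sup>d - \<omega>\<^sub>a \<delta>\<^sub>b\<^sup>d - \<omega>\<^sub>b \<delta>\<^sub>a\<^sup>d\<close> be the Thomas
  symbols. They are trace free and depend only on the projective class, and so does the Schouten tensor
  \<open>P\<close> formed from them, which is symmetric. In the jet frame the cotractor connection involves only \<open>\<Pi>\<close>
  and \<open>P\<close>, and the tractor curvature is block triangular, its only diagonal block that can be nonzero
  being \<open>W\<^sub>a\<^sub>b\<^sup>c\<^sub>d = R\<^sub>a\<^sub>b\<^sup>c\<^sub>d - \<delta>\<^sub>a\<^sup>c P\<^sub>b\<^sub>d + \<delta>\<^sub>b\<^sup>c P\<^sub>a\<^sub>d\<close> with the curvature \<open>R\<close> of \<open>\<Pi>\<close>. Hence \<open>q\<^sub>k\<close> is the alternated trace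
  of \<open>W\<^sup>k\<close>. The curvature of a scale connection is \<open>W\<close> plus the same wedge expression in its own
  Schouten tensor, and the wedge terms drop out of the alternated trace because any factor that
  precedes them satisfies the Bianchi identity.\<close>

section \<open>Calculus of \<open>C\<^sup>k\<close> maps\<close>

text \<open>On an open set the derivative at a point is determined by the values nearby, so equality
  of the functions on \<open>S\<close> passes to their derivatives and the induction goes
  through.\<close>

lemma Ck_on_cong:
  assumes "open S" "\<And>x. x \<in> S \<Longrightarrow> f x = g x" "Ck_on k f S"
  shows "Ck_on k g S"
  using assms(2,3)
proof (induction k arbitrary: f g)
  case 0
  then show ?case by (simp cong: continuous_on_cong)
next
  case (Suc k)
  have D: "(g has_derivative frechet_derivative f (at x)) (at x)" if "x \<in> S" for x
  proof (rule has_derivative_transform_within_open[OF _ assms(1) that Suc.prems(1)])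
    show "(f has_derivative frechet_derivative f (at x)) (at x)"
      using Suc.prems(2) assms(1) that
      by (simp add: differentiable_on_eq_differentiable_at frechet_derivative_works)
  qed
  have "g differentiable_on S"
    using D assms(1) by (auto simp: differentiable_on_eq_differentiable_at differentiable_def)
  moreover have "Ck_on k (\<lambda>x. frechet_derivative g (at x) v) S" for v
  proof (rule Suc.IH)
    show "frechet_derivative f (at x) v = frechet_derivative g (at x) v" if "x \<in> S" for x
      using frechet_derivative_at[OF D[OF that]] by simp
    show "Ck_on k (\<lambda>x. frechet_derivative f (at x) v) S" using Suc.prems(2) by simp
  qed
  ultimately show ?case by simp
qed

lemma Ck_on_subset: "Ck_on k f S \<Longrightarrow> T \<subseteq> S \<Longrightarrow> Ck_on k f T"
  by (induction k arbitrary: f) (auto intro: continuous_on_subset differentiable_on_subset)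

lemma Ck_on_Suc_imp: "Ck_on (Suc k) f S \<Longrightarrow> Ck_on k f S"
  by (induction k arbitrary: f) (auto intro: differentiable_imp_continuous_on)

text \<open>Uniqueness of the derivative allows the choice made by \<open>frechet_derivative\<close>
  to be replaced with any explicit derivative \<open>D\<close>, so that the rules of differentiation
  apply directly.\<close>

lemma Ck_on_SucI:
  assumes "open S" "\<And>x. x \<in> S \<Longrightarrow> (f has_derivative D x) (at x)" "\<And>v. Ck_on k (\<lambda>x. D x v) S"
  shows "Ck_on (Suc k) f S"
proof -
  have "f differentiable_on S"
    using assms(1,2) by (auto simp: differentiable_on_eq_differentiable_at differentiable_def)
  moreover have "Ck_on k (\<lambda>x. frechet_derivative f (at x) v) S" for v
    by (rule Ck_on_cong[OF assms(1) _ assms(3)[of v]])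
       (use frechet_derivative_at[OF assms(2)] in metis)
  ultimately show ?thesis by simp
qed

lemma Ck_on_has_derivative:
  assumes "Ck_on (Suc k) f S" "open S" "x \<in> S"
  shows "(f has_derivative frechet_derivative f (at x)) (at x)"
  using assms by (simp add: differentiable_on_eq_differentiable_at frechet_derivative_works)

section \<open>Closure properties of C^k maps\<close>

lemma Ck_on_const: "open S \<Longrightarrow> Ck_on k (\<lambda>_. c) S"
  by (induction k arbitrary: c) (auto simp: differentiable_on_def)

lemma Ck_on_add:
  assumes "open S" "Ck_on k f S" "Ck_on k g S"
  shows "Ck_on k (\<lambda>x. f x + g x) S"
  using assms(2,3)
proof (induction k arbitrary: f g)
  case 0
  then show ?case by (simp add: continuous_on_add)
next
  case (Suc k)
  show ?case
    by (rule Ck_on_SucI[OF assms(1) has_derivative_add[OF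
            Ck_on_has_derivative[OF Suc.prems(1) assms(1)] Ck_on_has_derivative[OF Suc.prems(2) assms(1)]]])
       (use Suc in simp_all)
qed

lemma Ck_on_sum:
  assumes "open S" "finite I" "\<And>i. i \<in> I \<Longrightarrow> Ck_on k (f i) S"
  shows "Ck_on k (\<lambda>x. \<Sum>i\<in>I. f i x) S"
  using assms(2,3) by induction (auto intro: Ck_on_const[OF assms(1)] Ck_on_add[OF assms(1)])

lemma Ck_on_bounded_linear:
  assumes "open S" "bounded_linear L" "Ck_on k f S"
  shows "Ck_on k (\<lambda>x. L (f x)) S"
  using assms(3)
proof (induction k arbitrary: f)
  case 0
  then show ?case using assms(2) by (simp add: bounded_linear.continuous_on)
next
  case (Suc k)
  show ?case
    by (rule Ck_on_SucI[OF assms(1) bounded_linear.has_derivative[OF assms(2)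
            Ck_on_has_derivative[OF Suc.prems assms(1)]]])
       (use Suc in simp_all)
qed

lemma Ck_on_scaleR:
  assumes "open S" "Ck_on k f S" "Ck_on k g S"
  shows "Ck_on k (\<lambda>x. f x *\<^sub>R g x) S"
  using assms(2,3)
proof (induction k arbitrary: f g)
  case 0
  then show ?case by (simp add: continuous_on_scaleR)
next
  case (Suc k)
  show ?case
  proof (rule Ck_on_SucI[OF assms(1) has_derivative_scaleR[OF
          Ck_on_has_derivative[OF Suc.prems(1) assms(1)] Ck_on_has_derivative[OF Suc.prems(2) assms(1)]]])
    show "Ck_on k (\<lambda>x. f x *\<^sub>R frechet_derivative g (at x) v + frechet_derivative f (at x) v *\<^sub>R g x) S" for v
      by (intro Ck_on_add[OF assms(1)] Suc.IH Ck_on_Suc_imp[OF Suc.prems(1)] Ck_on_Suc_imp[OF Suc.prems(2)])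
         (use Suc.prems in auto)
  qed
qed

lemma Ck_on_compose:
  fixes f :: "'a::euclidean_space \<Rightarrow> 'b::euclidean_space"
  assumes "open S" "open T" "f ` S \<subseteq> T" "Ck_on k f S" "Ck_on k g T"
  shows "Ck_on k (g \<circ> f) S"
  using assms(4,5)
proof (induction k arbitrary: g)
  case 0
  then have "continuous_on S f" "continuous_on (f ` S) g"
    using continuous_on_subset[OF _ assms(3)] by auto
  then show ?case unfolding Ck_on.simps by (rule continuous_on_compose)
next
  case (Suc k)
  let ?D = "\<lambda>x. frechet_derivative g (at (f x)) \<circ> frechet_derivative f (at x)"
  have D: "(g \<circ> f has_derivative ?D x) (at x)" if "x \<in> S" for x
    by (rule diff_chain_at[OF Ck_on_has_derivative[OF Suc.prems(1) assms(1) that]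
          Ck_on_has_derivative[OF Suc.prems(2) assms(2)]]) (use that assms(3) in auto)
  have lin: "linear (frechet_derivative g (at (f x)))" if "x \<in> S" for x
    by (rule has_derivative_linear[OF Ck_on_has_derivative[OF Suc.prems(2) assms(2)]])
       (use that assms(3) in auto)
  show ?case
  proof (rule Ck_on_SucI[OF assms(1) D])
    fix v
    \<comment> \<open>The direction \<open>frechet_derivative f (at x) v\<close> varies with
      \<open>x\<close>, whereas \<open>Ck_on\<close> speaks of fixed directions. Expanding it in
      \<open>Basis\<close> gives a sum of products to which the induction hypothesis
      applies.\<close>
    let ?h = "\<lambda>x. \<Sum>b\<in>Basis. (frechet_derivative f (at x) v \<bullet> b) *\<^sub>R ((\<lambda>y. frechet_derivative g (at y) b) \<circ> f) x"
    have "Ck_on k (\<lambda>x. frechet_derivative f (at x) v \<bullet> b) S" for b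
      by (rule Ck_on_bounded_linear[OF assms(1) bounded_linear_inner_left]) (use Suc.prems in simp)
    then have "Ck_on k ?h S"
      using Suc.prems(2)
      by (intro Ck_on_sum[OF assms(1) finite_Basis] Ck_on_scaleR[OF assms(1)]
          Suc.IH[OF Ck_on_Suc_imp[OF Suc.prems(1)]]) simp_all
    then show "Ck_on k (\<lambda>x. ?D x v) S"
    proof (rule Ck_on_cong[OF assms(1), rotated])
      fix x assume "x \<in> S"
      have "?D x v = frechet_derivative g (at (f x)) (\<Sum>b\<in>Basis. (frechet_derivative f (at x) v \<bullet> b) *\<^sub>R b)"
        by (simp add: euclidean_representation)
      then show "?h x = ?D x v"
        using lin[OF \<open>x \<in> S\<close>] by (simp add: linear_sum linear_scale)
    qed
  qed
qed

text \<open>The derivative is a multiple of another power, so the induction runs with the exponent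
  arbitrary. Exponents \<open>1 / n\<close> give the roots in the density transition
  functions.\<close>

lemma Ck_on_powr:
  fixes a :: real
  shows "Ck_on k (\<lambda>x. x powr a) {0<..}"
proof (induction k arbitrary: a)
  case 0
  show ?case by (auto intro!: continuous_intros)
next
  case (Suc k)
  show ?case
  proof (rule Ck_on_SucI)
    fix x :: real assume "x \<in> {0<..}"
    then have "((\<lambda>x. x powr a) has_real_derivative a * x powr (a - 1)) (at x)"
      by (auto intro!: derivative_eq_intros)
    then show "((\<lambda>x. x powr a) has_derivative (\<lambda>v. v *\<^sub>R (a * x powr (a - 1)))) (at x)"
      unfolding has_field_derivative_def
      by (rule has_derivative_eq_rhs) (simp add: fun_eq_iff)
  next
    have "Ck_on k (\<lambda>x. (v * a) *\<^sub>R (x powr (a - 1))) {0<..}" for v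
      by (rule Ck_on_bounded_linear[OF open_greaterThan bounded_linear_scaleR_right Suc])
    then show "Ck_on k (\<lambda>x. v *\<^sub>R (a * x powr (a - 1))) {0<..}" for v by (simp add: mult.assoc)
  qed auto
qed

lemma Ck_on_root:
  assumes "n > 0"
  shows "Ck_on k (root n) {0<..}"
proof (rule Ck_on_cong[OF _ _ Ck_on_powr[of k "1 / n"]])
  show "x powr (1 / n) = root n x" if "x \<in> {0<..}" for x
    using that assms by (simp add: root_powr_inverse)
qed auto

lemma Ck_on_component:
  fixes f :: "'a::euclidean_space \<Rightarrow> real^'r::finite"
  assumes "open S"
  shows "Ck_on k f S \<longleftrightarrow> (\<forall>i. Ck_on k (\<lambda>x. f x $ i) S)"
proof
  assume "\<forall>i. Ck_on k (\<lambda>x. f x $ i) S"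
  then have "Ck_on k (\<lambda>x. \<Sum>i\<in>UNIV. f x $ i *\<^sub>R (axis i 1 :: real^'r)) S"
    by (intro Ck_on_sum Ck_on_scaleR Ck_on_const assms) auto
  moreover have "(\<Sum>i\<in>UNIV. f x $ i *\<^sub>R axis i 1) = f x" for x
    by (simp add: vec_eq_iff axis_def if_distrib cong: if_cong)
  ultimately show "Ck_on k f S" by simp
qed (use Ck_on_bounded_linear[OF assms bounded_linear_vec_nth] in blast)

text \<open>The second difference of \<open>f\<close> over a small parallelogram at \<open>x\<close>
  is symmetric in the two sides. Two mean value theorems express it through either iterated
  derivative, and continuity at \<open>x\<close> forces the two to agree.\<close>

lemma mixed_partials_commute:
  fixes f :: "'a::euclidean_space \<Rightarrow> real"
  assumes S: "open S" "x \<in> S" and f: "Ck_on 2 f S"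
  shows "frechet_derivative (\<lambda>y. frechet_derivative f (at y) u) (at x) v
       = frechet_derivative (\<lambda>y. frechet_derivative f (at y) v) (at x) u"
proof -
  define D where "D v y = frechet_derivative f (at y) v" for v y
  define H where "H u v y = frechet_derivative (D u) (at y) v" for u v y
  have f1: "Ck_on (Suc 0) (D u) S" for u
    using f unfolding D_def numeral_2_eq_2 Ck_on.simps by blast
  have fd: "(f has_derivative (\<lambda>v. D v y)) (at y)" if "y \<in> S" for y
    using Ck_on_has_derivative[of "Suc 0" f S y] f S(1) that by (simp add: numeral_2_eq_2 D_def)
  have Dd: "(D u has_derivative (\<lambda>v. H u v y)) (at y)" if "y \<in> S" for u y
    using Ck_on_has_derivative[OF f1 S(1) that] by (simp add: H_def)
  have Hc: "isCont (H u v) x" for u v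
  proof -
    have "continuous_on S (H u v)" using f1[of u] by (simp add: H_def[abs_def])
    then show ?thesis using S by (simp add: continuous_on_eq_continuous_at)
  qed
  text \<open>The second difference of \<open>f\<close> over a parallelogram is a value of \<open>H u v\<close> inside it.\<close>
  have key: "\<exists>p q. 0 < p \<and> p < t \<and> 0 < q \<and> q < t \<and>
      f (x + t *\<^sub>R u + t *\<^sub>R v) - f (x + t *\<^sub>R u) - f (x + t *\<^sub>R v) + f x = t * t * H u v (x + p *\<^sub>R u + q *\<^sub>R v)"
    if t: "t > 0" and B: "\<And>p q. 0 \<le> p \<Longrightarrow> p \<le> t \<Longrightarrow> 0 \<le> q \<Longrightarrow> q \<le> t \<Longrightarrow> x + p *\<^sub>R u + q *\<^sub>R v \<in> S"
    for t u v
  proof -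
    \<comment> \<open>\<open>?g p\<close> is a difference of \<open>f\<close> in the direction
      \<open>v\<close>; the vanishing summand \<open>0 *\<^sub>R v\<close> gives both of its terms
      the shape treated in \<open>fl\<close>.\<close>
    let ?g = "\<lambda>p. f (x + p *\<^sub>R u + t *\<^sub>R v) - f (x + p *\<^sub>R u + 0 *\<^sub>R v)"
    have line: "((\<lambda>p. h (z + p *\<^sub>R w)) has_real_derivative h' w) (at p)"
      if "(h has_derivative h') (at (z + p *\<^sub>R w))" for h :: "'a \<Rightarrow> real" and h' z w p
    proof -
      have "((\<lambda>p. z + p *\<^sub>R w) has_derivative (\<lambda>r. r *\<^sub>R w)) (at p)"
        by (auto intro!: derivative_eq_intros)
      from has_derivative_compose[OF this that]
      show ?thesis using has_derivative_linear[OF that]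
        by (simp add: has_field_derivative_def linear_scale mult_commute_abs)
    qed
    have fl: "((\<lambda>p. f (x + p *\<^sub>R u + q *\<^sub>R v)) has_real_derivative D u (x + p *\<^sub>R u + q *\<^sub>R v)) (at p)"
      if "0 \<le> p" "p \<le> t" "0 \<le> q" "q \<le> t" for p q
      using line[of f _ "x + q *\<^sub>R v" p u] fd[OF B[OF that]] by (simp add: algebra_simps)
    have "((\<lambda>p. ?g p) has_real_derivative
        D u (x + p *\<^sub>R u + t *\<^sub>R v) - D u (x + p *\<^sub>R u + 0 *\<^sub>R v)) (at p)" if "0 \<le> p" "p \<le> t" for p
      using that t by (intro DERIV_diff fl) auto
    from MVT2[OF t this] obtain p where p: "0 < p" "p < t"
      "?g t - ?g 0 = (t - 0) * (D u (x + p *\<^sub>R u + t *\<^sub>R v) - D u (x + p *\<^sub>R u + 0 *\<^sub>R v))" by auto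
    have "((\<lambda>q. D u (x + p *\<^sub>R u + q *\<^sub>R v)) has_real_derivative H u v (x + p *\<^sub>R u + q *\<^sub>R v)) (at q)"
      if "0 \<le> q" "q \<le> t" for q
      using line[of "D u" _ "x + p *\<^sub>R u" q v] Dd[OF B, of p q u] that p by simp
    from MVT2[OF t this] obtain q where q: "0 < q" "q < t"
      "D u (x + p *\<^sub>R u + t *\<^sub>R v) - D u (x + p *\<^sub>R u + 0 *\<^sub>R v) = (t - 0) * H u v (x + p *\<^sub>R u + q *\<^sub>R v)"
      by auto
    show ?thesis using p q by (intro exI[of _ p] exI[of _ q]) (simp add: algebra_simps)
  qed
  have "H u v x = H v u x"
  proof (rule ccontr)
    assume ne: "H u v x \<noteq> H v u x"
    \<comment> \<open>Half the gap between the two values: no number is within \<open>e\<close> of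
      both.\<close>
    define e where "e = \<bar>H u v x - H v u x\<bar> / 2"
    have e: "e > 0" using ne by (simp add: e_def)
    obtain d1 where d1: "d1 > 0" "\<And>y. dist y x < d1 \<Longrightarrow> dist (H u v y) (H u v x) < e"
      using Hc[of u v] e unfolding continuous_at_eps_delta by metis
    obtain d2 where d2: "d2 > 0" "\<And>y. dist y x < d2 \<Longrightarrow> dist (H v u y) (H v u x) < e"
      using Hc[of v u] e unfolding continuous_at_eps_delta by metis
    obtain d3 where d3: "d3 > 0" "\<And>y. dist y x < d3 \<Longrightarrow> y \<in> S"
      using S unfolding open_dist by metis
    define d where "d = min d1 (min d2 d3)"
    \<comment> \<open>Chosen so that the parallelogram with sides \<open>t *\<^sub>R u\<close> and
      \<open>t *\<^sub>R v\<close> lies in the ball of radius \<open>d\<close> about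
      \<open>x\<close>.\<close>
    define t where "t = d / (norm u + norm v + 1)"
    have nn: "norm u + norm v + 1 > 0" by (smt (verit) norm_ge_zero)
    have d: "d > 0" using d1 d2 d3 by (simp add: d_def)
    have t: "t > 0" using d nn by (simp add: t_def)
    have near: "dist (x + p *\<^sub>R u + q *\<^sub>R v) x < d" if "0 \<le> p" "p \<le> t" "0 \<le> q" "q \<le> t" for p q
    proof -
      have "dist (x + p *\<^sub>R u + q *\<^sub>R v) x = norm (p *\<^sub>R u + q *\<^sub>R v)"
        by (simp add: dist_norm algebra_simps)
      also have "\<dots> \<le> p * norm u + q * norm v"
        using norm_triangle_ineq[of "p *\<^sub>R u" "q *\<^sub>R v"] that by simp
      also have "\<dots> \<le> t * norm u + t * norm v"
        using that by (intro add_mono mult_right_mono) auto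
      also have "\<dots> < t * (norm u + norm v + 1)" using t by (simp add: algebra_simps)
      also have "\<dots> = d" using nn by (simp add: t_def)
      finally show ?thesis .
    qed
    obtain p q where 1: "0 < p" "p < t" "0 < q" "q < t"
      "f (x + t *\<^sub>R u + t *\<^sub>R v) - f (x + t *\<^sub>R u) - f (x + t *\<^sub>R v) + f x = t * t * H u v (x + p *\<^sub>R u + q *\<^sub>R v)"
      using key[OF t, of u v] near d3(2) by (auto simp: d_def)
    have near': "dist (x + p *\<^sub>R v + q *\<^sub>R u) x < d" if "0 \<le> p" "p \<le> t" "0 \<le> q" "q \<le> t" for p q
      using near[of q p] that by (simp add: algebra_simps)
    obtain r s where 2: "0 < r" "r < t" "0 < s" "s < t"
      "f (x + t *\<^sub>R v + t *\<^sub>R u) - f (x + t *\<^sub>R v) - f (x + t *\<^sub>R u) + f x = t * t * H v u (x + r *\<^sub>R v + s *\<^sub>R u)"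
      using key[OF t, of v u] near' d3(2) by (auto simp: d_def)
    have "t * t * H u v (x + p *\<^sub>R u + q *\<^sub>R v) = t * t * H v u (x + r *\<^sub>R v + s *\<^sub>R u)"
      using 1(5) 2(5) by (simp add: algebra_simps)
    then have eq: "H u v (x + p *\<^sub>R u + q *\<^sub>R v) = H v u (x + r *\<^sub>R v + s *\<^sub>R u)"
      using t by simp
    have "dist (H u v (x + p *\<^sub>R u + q *\<^sub>R v)) (H u v x) < e"
      using d1(2) near[of p q] 1 by (simp add: d_def)
    moreover have "dist (H v u (x + r *\<^sub>R v + s *\<^sub>R u)) (H v u x) < e"
      using d2(2) near'[of r s] 2 by (simp add: d_def)
    ultimately show False unfolding eq dist_real_def e_def by (simp add: abs_if split: if_splits)
  qed
  then show ?thesis by (simp add: H_def D_def[abs_def])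
qed

section \<open>Smooth functions and bundles over an atlas\<close>

lemma smooth_on_frechet_derivative:
  "smooth_on S f \<Longrightarrow> smooth_on S (\<lambda>x. frechet_derivative f (at x) v)"
  unfolding smooth_on_def using Ck_on.simps(2) by blast

lemma smooth_in_subset: "smooth_in c U f \<Longrightarrow> V \<inter> cdom c \<subseteq> U \<Longrightarrow> smooth_in c V f"
  unfolding smooth_in_def smooth_on_def
  by (meson Ck_on_subset Int_lower2 image_mono le_inf_iff)

section \<open>Rules for partial derivatives in a chart\<close>

lemma pd_component:
  fixes f :: "'m \<Rightarrow> real^'r::finite"
  assumes "(f \<circ> param c) differentiable (at (coord c x))"
  shows "pd c a f x $ i = pd c a (\<lambda>z. f z $ i) x"
proof -
  have "(f \<circ> param c has_derivative frechet_derivative (f \<circ> param c) (at (coord c x))) (at (coord c x))"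
    using assms by (simp add: frechet_derivative_works)
  from frechet_derivative_at[OF bounded_linear.has_derivative[OF bounded_linear_vec_nth this]]
  show ?thesis by (simp add: pd_def o_def fun_eq_iff)
qed

lemma pd_const [simp]: "pd c a (\<lambda>_. k) x = 0"
  by (simp add: pd_def o_def)

lemma pd_add:
  assumes "(f \<circ> param c) differentiable (at (coord c x))" "(g \<circ> param c) differentiable (at (coord c x))"
  shows "pd c a (\<lambda>z. f z + g z) x = pd c a f x + pd c a g x"
  using frechet_derivative_at[OF has_derivative_add[OF assms[unfolded frechet_derivative_works]]]
  by (simp add: pd_def o_def fun_eq_iff)

lemma pd_sum:
  assumes "\<And>i. i \<in> I \<Longrightarrow> (f i \<circ> param c) differentiable (at (coord c x))"
  shows "pd c a (\<lambda>z. \<Sum>i\<in>I. f i z) x = (\<Sum>i\<in>I. pd c a (f i) x)"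
proof -
  have "((\<lambda>y. \<Sum>i\<in>I. (f i \<circ> param c) y) has_derivative
      (\<lambda>v. \<Sum>i\<in>I. frechet_derivative (f i \<circ> param c) (at (coord c x)) v)) (at (coord c x))"
    by (rule has_derivative_sum) (rule assms[unfolded frechet_derivative_works])
  from frechet_derivative_at[OF this, symmetric] show ?thesis by (simp add: pd_def o_def)
qed

lemma pd_mult:
  fixes f g :: "'m \<Rightarrow> real"
  assumes "param c (coord c x) = x"
    and "(f \<circ> param c) differentiable (at (coord c x))" "(g \<circ> param c) differentiable (at (coord c x))"
  shows "pd c a (\<lambda>z. f z * g z) x = pd c a f x * g x + f x * pd c a g x"
  using frechet_derivative_at[OF has_derivative_mult[OF assms(2,3)[unfolded frechet_derivative_works]], symmetric] assms(1)
  by (simp add: pd_def o_def)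

lemma sum_UNIV_option: "(\<Sum>i\<in>UNIV. f i) = f None + (\<Sum>a\<in>UNIV. f (Some a))"
  for f :: "'a::finite option \<Rightarrow> 'b::comm_monoid_add"
  by (simp add: UNIV_option_conv sum.reindex)

text \<open>The type \<open>vbundle\<close> admits arbitrary families of matrices; these are the
  conditions that make such a family a smooth vector bundle. Smoothness of \<open>E c d\<close> is
  asked in the coordinates of \<open>c\<close> and is carried to those of \<open>d\<close> by a
  change of chart.\<close>

definition smooth_cocycle ::
  "('m::topological_space, 'n::finite) chart set \<Rightarrow> ('m, 'n, 'r::finite) vbundle \<Rightarrow> bool" where
  "smooth_cocycle A E \<longleftrightarrow>
     (\<forall>c\<in>A. \<forall>x\<in>cdom c. E c c x = mat 1) \<and>
     (\<forall>c\<in>A. \<forall>d\<in>A. \<forall>e\<in>A. \<forall>x\<in>cdom c \<inter> cdom d \<inter> cdom e. E d e x ** E c d x = E c e x) \<and>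
     (\<forall>c\<in>A. \<forall>d\<in>A. \<forall>i j. smooth_in c (cdom d) (\<lambda>x. E c d x $ i $ j))"

context
  fixes A :: "('m::{t2_space,second_countable_topology}, 'n::finite) chart set"
  assumes atlas: "smooth_atlas A"
begin

lemma open_cdom: "c \<in> A \<Longrightarrow> open (cdom c)"
  using atlas by (simp add: smooth_atlas_def)

text \<open>Functions that agree near \<open>x\<close> have the same set of derivatives there, so
  \<open>frechet_derivative\<close> makes the same choice for both, even when that set is
  empty.\<close>

lemma pd_cong:
  fixes f :: "'m \<Rightarrow> 'b::real_normed_vector"
  assumes c: "c \<in> A" and U: "open U" "x \<in> U \<inter> cdom c" and eq: "\<And>z. z \<in> U \<inter> cdom c \<Longrightarrow> f z = g z"
  shows "pd c a f x = pd c a g x"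
proof -
  have *: "(h \<circ> param c has_derivative D) (at (coord c x))"
    if "(h' \<circ> param c has_derivative D) (at (coord c x))" "\<And>z. z \<in> U \<inter> cdom c \<Longrightarrow> h' z = h z" for h h' :: "'m \<Rightarrow> 'b" and D
    by (rule has_derivative_transform_within_open[OF that(1) open_coord_image[OF atlas c U(1)]])
       (use U that(2) in \<open>auto simp: param_coord[OF atlas c]\<close>)
  have "(f \<circ> param c has_derivative D) (at (coord c x)) = (g \<circ> param c has_derivative D) (at (coord c x))" for D
    using *[of f D g] *[of g D f] eq by metis
  then show ?thesis by (simp add: pd_def frechet_derivative_def)
qed

lemma smooth_in_cong:
  assumes c: "c \<in> A" and U: "open U" and eq: "\<And>z. z \<in> U \<inter> cdom c \<Longrightarrow> f z = g z"
    and f: "smooth_in c U f"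
  shows "smooth_in c U g"
  unfolding smooth_in_def smooth_on_def
proof
  fix k
  show "Ck_on k (g \<circ> param c) (coord c ` (U \<inter> cdom c))"
    by (rule Ck_on_cong[OF open_coord_image[OF atlas c U], of "f \<circ> param c"])
       (use f eq in \<open>auto simp: smooth_in_def smooth_on_def param_coord[OF atlas c]\<close>)
qed

lemma smooth_in_differentiable:
  assumes c: "c \<in> A" and U: "open U" "x \<in> U \<inter> cdom c" and f: "smooth_in c U f"
  shows "(f \<circ> param c) differentiable (at (coord c x))"
proof -
  have "Ck_on (Suc 0) (f \<circ> param c) (coord c ` (U \<inter> cdom c))"
    using f by (auto simp: smooth_in_def smooth_on_def)
  from Ck_on_has_derivative[OF this open_coord_image[OF atlas c U(1)]] U
  show ?thesis by (auto intro: differentiableI)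
qed

lemma smooth_in_const: "c \<in> A \<Longrightarrow> open U \<Longrightarrow> smooth_in c U (\<lambda>_. k)"
  unfolding smooth_in_def smooth_on_def o_def by (intro allI Ck_on_const open_coord_image[OF atlas])

lemma smooth_in_add:
  "c \<in> A \<Longrightarrow> open U \<Longrightarrow> smooth_in c U f \<Longrightarrow> smooth_in c U g \<Longrightarrow> smooth_in c U (\<lambda>x. f x + g x)"
  unfolding smooth_in_def smooth_on_def o_def
  by (intro allI Ck_on_add[OF open_coord_image[OF atlas]]) blast+

lemma smooth_in_sum:
  "c \<in> A \<Longrightarrow> open U \<Longrightarrow> finite I \<Longrightarrow> (\<And>i. i \<in> I \<Longrightarrow> smooth_in c U (f i)) \<Longrightarrow> smooth_in c U (\<lambda>x. \<Sum>i\<in>I. f i x)"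
  unfolding smooth_in_def smooth_on_def o_def
  by (intro allI Ck_on_sum[OF open_coord_image[OF atlas]]) blast+

lemma smooth_in_scaleR:
  "c \<in> A \<Longrightarrow> open U \<Longrightarrow> smooth_in c U f \<Longrightarrow> smooth_in c U g \<Longrightarrow> smooth_in c U (\<lambda>x. f x *\<^sub>R g x)"
  unfolding smooth_in_def smooth_on_def o_def
  by (intro allI Ck_on_scaleR[OF open_coord_image[OF atlas]]) blast+

lemma smooth_in_mult:
  fixes f g :: "'m \<Rightarrow> real"
  shows "c \<in> A \<Longrightarrow> open U \<Longrightarrow> smooth_in c U f \<Longrightarrow> smooth_in c U g \<Longrightarrow> smooth_in c U (\<lambda>x. f x * g x)"
  using smooth_in_scaleR[of c U f g] by simp

lemma smooth_in_minus:
  fixes f :: "'m \<Rightarrow> real"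
  shows "c \<in> A \<Longrightarrow> open U \<Longrightarrow> smooth_in c U f \<Longrightarrow> smooth_in c U (\<lambda>x. - f x)"
  using smooth_in_mult[OF _ _ smooth_in_const[of c U "-1"]] by simp

lemma smooth_in_diff:
  fixes f g :: "'m \<Rightarrow> real"
  shows "c \<in> A \<Longrightarrow> open U \<Longrightarrow> smooth_in c U f \<Longrightarrow> smooth_in c U g \<Longrightarrow> smooth_in c U (\<lambda>x. f x - g x)"
  using smooth_in_add[OF _ _ _ smooth_in_minus, of c U f g] by simp

lemma smooth_in_prod:
  fixes f :: "'i \<Rightarrow> 'm \<Rightarrow> real"
  assumes "c \<in> A" "open U" "finite I" "\<And>i. i \<in> I \<Longrightarrow> smooth_in c U (f i)"
  shows "smooth_in c U (\<lambda>x. \<Prod>i\<in>I. f i x)"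
  using assms(3,4) by induction (simp_all add: smooth_in_const[OF assms(1,2)] smooth_in_mult[OF assms(1,2)])

lemma smooth_in_component:
  fixes f :: "'m \<Rightarrow> real^'r::finite"
  assumes "c \<in> A" "open U"
  shows "smooth_in c U f \<longleftrightarrow> (\<forall>i. smooth_in c U (\<lambda>x. f x $ i))"
  using Ck_on_component[OF open_coord_image[OF atlas assms], of _ "f \<circ> param c"]
  by (auto simp add: smooth_in_def smooth_on_def o_def)

lemma smooth_in_root:
  assumes c: "c \<in> A" and U: "open U" and f: "smooth_in c U f" and n: "n > 0"
    and pos: "\<And>x. x \<in> U \<inter> cdom c \<Longrightarrow> f x > 0"
  shows "smooth_in c U (\<lambda>x. root n (f x))"
  unfolding smooth_in_def smooth_on_def
proof
  fix k
  have "Ck_on k (root n \<circ> (f \<circ> param c)) (coord c ` (U \<inter> cdom c))"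
    by (rule Ck_on_compose[OF open_coord_image[OF atlas c U] open_greaterThan _ _ Ck_on_root[OF n]])
       (use f pos in \<open>auto simp: smooth_in_def smooth_on_def param_coord[OF atlas c]\<close>)
  then show "Ck_on k ((\<lambda>x. root n (f x)) \<circ> param c) (coord c ` (U \<inter> cdom c))" by (simp add: o_def)
qed

lemma smooth_in_change:
  assumes c: "c \<in> A" and d: "d \<in> A" and U: "open U" "U \<inter> cdom d \<subseteq> cdom c" and f: "smooth_in c U f"
  shows "smooth_in d U f"
  unfolding smooth_in_def smooth_on_def
proof
  fix k
  let ?S = "coord d ` (U \<inter> cdom d)"
  note oS = open_coord_image[OF atlas d U(1)]
  have "Ck_on k ((f \<circ> param c) \<circ> (coord c \<circ> param d)) ?S"
  proof (rule Ck_on_compose[OF oS open_coord_image[OF atlas c U(1)]])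
    show "Ck_on k (coord c \<circ> param d) ?S"
      by (rule Ck_on_subset[OF transition_Ck[OF atlas d c]]) (use U in auto)
  qed (use f U in \<open>auto simp: smooth_in_def smooth_on_def param_coord[OF atlas d]\<close>)
  then show "Ck_on k (f \<circ> param d) ?S"
    by (rule Ck_on_cong[OF oS, rotated]) (use U in \<open>auto simp: param_coord[OF atlas d] param_coord[OF atlas c]\<close>)
qed

text \<open>Both statements concern only the overlap of the two charts, where smoothness does not
  depend on the chart used.\<close>

lemma smooth_in_swap:
  fixes f :: "'m \<Rightarrow> 'b::real_normed_vector"
  assumes c: "c \<in> A" and d: "d \<in> A" and f: "smooth_in d (cdom c) f"
  shows "smooth_in c (cdom d) f"
proof -
  have "smooth_in c (cdom d \<inter> cdom c) f"
    by (rule smooth_in_change[OF d c _ _ smooth_in_subset[OF f]])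
       (use open_Int[OF open_cdom[OF d] open_cdom[OF c]] in auto)
  then show ?thesis by (rule smooth_in_subset) auto
qed

lemma smooth_in_pd:
  assumes c: "c \<in> A" and U: "open U" and f: "smooth_in c U f"
  shows "smooth_in c U (pd c a f)"
  unfolding smooth_in_def smooth_on_def
proof
  fix k
  let ?S = "coord c ` (U \<inter> cdom c)"
  have "Ck_on k (\<lambda>y. frechet_derivative (f \<circ> param c) (at y) (axis a 1)) ?S"
    using smooth_on_frechet_derivative[of ?S "f \<circ> param c"] f by (auto simp: smooth_in_def smooth_on_def)
  then show "Ck_on k (pd c a f \<circ> param c) ?S"
    by (rule Ck_on_cong[OF open_coord_image[OF atlas c U], rotated])
       (auto simp: pd_def param_coord[OF atlas c])
qed

lemma pd_commute:
  fixes f :: "'m \<Rightarrow> real"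
  assumes c: "c \<in> A" and U: "open U" "x \<in> U \<inter> cdom c" and f: "smooth_in c U f"
  shows "pd c a (pd c b f) x = pd c b (pd c a f) x"
proof -
  let ?S = "coord c ` (U \<inter> cdom c)" and ?f = "f \<circ> param c"
  note oS = open_coord_image[OF atlas c U(1)]
  have S: "coord c x \<in> ?S" using U by auto
  have e: "frechet_derivative (pd c b f \<circ> param c) (at (coord c x)) =
      frechet_derivative (\<lambda>y. frechet_derivative ?f (at y) (axis b 1)) (at (coord c x))" for b
  proof (rule frechet_derivative_transform_within_open[OF _ oS S])
    show "(pd c b f \<circ> param c) differentiable at (coord c x)"
      by (rule smooth_in_differentiable[OF c U smooth_in_pd[OF c U(1) f]])
  qed (auto simp: pd_def param_coord[OF atlas c])
  show ?thesis
    unfolding pd_def[of c _ "pd c _ f"] e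
    by (rule mixed_partials_commute[OF oS S]) (use f in \<open>auto simp: smooth_in_def smooth_on_def\<close>)
qed

section \<open>Transition functions of the tangent, density and cotractor bundles\<close>

lemma pd_coord:
  assumes c: "c \<in> A" and x: "x \<in> cdom c"
  shows "pd c a (\<lambda>z. coord c z $ b) x = (if a = b then 1 else 0)"
proof -
  have o: "open (coord c ` cdom c)" "coord c x \<in> coord c ` cdom c"
    using atlas c x by (auto simp: smooth_atlas_def)
  have D: "((\<lambda>z. coord c z $ b) \<circ> param c has_derivative (\<lambda>v. v $ b)) (at (coord c x))"
    by (rule has_derivative_transform_within_open[OF
          bounded_linear.has_derivative[OF bounded_linear_vec_nth has_derivative_ident] o])
       (auto simp: param_coord[OF atlas c])
  show ?thesis
    using frechet_derivative_at[OF D, symmetric] by (simp add: pd_def axis_def)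
qed

lemma smooth_in_coord:
  assumes c: "c \<in> A" and d: "d \<in> A"
  shows "smooth_in c (cdom d) (\<lambda>z. coord d z $ b)"
proof -
  have "Ck_on k (\<lambda>y. (coord d \<circ> param c) y $ b) (coord c ` (cdom c \<inter> cdom d))" for k
    using transition_Ck[OF atlas c d] Ck_on_component[OF open_overlap[OF atlas c d]] by blast
  then show ?thesis by (simp add: smooth_in_def smooth_on_def o_def Int_commute)
qed

lemma smooth_in_tangent:
  assumes c: "c \<in> A" and d: "d \<in> A"
  shows "smooth_in c (cdom d) (\<lambda>z. tangent c d z $ b $ a)"
  using smooth_in_pd[OF c open_cdom[OF d] smooth_in_coord[OF c d]] by (simp add: tangent_def)

lemma tangent_refl:
  assumes "c \<in> A" "x \<in> cdom c"
  shows "tangent c c x = mat 1"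
  by (simp add: vec_eq_iff tangent_def mat_def pd_coord[OF assms] eq_commute)

lemma tangent_cocycle:
  assumes "c \<in> A" "d \<in> A" "e \<in> A" "x \<in> cdom c \<inter> cdom d \<inter> cdom e"
  shows "tangent d e x ** tangent c d x = tangent c e x"
proof -
  have "pd c a (\<lambda>z. coord e z $ b) x = (\<Sum>k\<in>UNIV. tangent c d x $ k $ a * pd d k (\<lambda>z. coord e z $ b) x)" for a b
    by (rule pd_change_chart(2)[OF atlas assms(2,1) _
          smooth_in_differentiable[OF assms(2) open_cdom[OF assms(3)] _ smooth_in_coord[OF assms(2,3)]]])
       (use assms in auto)
  then show ?thesis
    by (simp add: vec_eq_iff matrix_matrix_mult_def tangent_def mult.commute)
qed

lemma det_tangent_nonzero:
  assumes "c \<in> A" "d \<in> A" "x \<in> cdom c \<inter> cdom d"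
  shows "det (tangent c d x) \<noteq> 0"
  using tangent_inverse[OF atlas assms] by (metis det_I det_mul mult_zero_right zero_neq_one)

text \<open>The determinant is a polynomial in the entries of the Jacobian. The root is smooth at
  positive arguments, and the squared determinant is positive because the Jacobian is
  invertible.\<close>

lemma smooth_in_density_transition:
  assumes c: "c \<in> A" and d: "d \<in> A"
  shows "smooth_in c (cdom d) (density_transition c d)"
proof -
  have det: "smooth_in c (cdom d) (\<lambda>z. det (tangent c d z))"
    unfolding det_def
    by (intro smooth_in_sum smooth_in_mult smooth_in_const smooth_in_prod smooth_in_tangent c d open_cdom)
       (auto simp: finite_permutations)
  have "smooth_in c (cdom d) (\<lambda>z. root (2 * CARD('n) + 2) ((det (tangent c d z))\<^sup>2))"
    unfolding power2_eq_square
    by (intro smooth_in_root smooth_in_mult det c open_cdom[OF d])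
       (use det_tangent_nonzero[OF c d] in \<open>force simp: zero_less_mult_iff\<close>)+
  then show ?thesis by (simp add: density_transition_def[abs_def])
qed

lemma density_transition_cocycle:
  assumes "c \<in> A" "d \<in> A" "e \<in> A" "x \<in> cdom c \<inter> cdom d \<inter> cdom e"
  shows "density_transition d e x * density_transition c d x = density_transition c e x"
  by (simp add: density_transition_def tangent_cocycle[OF assms, symmetric] det_mul
      power_mult_distrib real_root_mult)

lemma density_transition_refl:
  assumes "c \<in> A" "x \<in> cdom c"
  shows "density_transition c c x = 1"
  using assms by (simp add: density_transition_def tangent_refl del: real_root_pow_pos)

lemma smooth_cocycle_tangent: "smooth_cocycle A tangent"
  unfolding smooth_cocycle_def
  using tangent_refl tangent_cocycle smooth_in_tangent by blast

text \<open>Beyond the cocycle properties of densities and Jacobians, only the derivatives of the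
  density transition in column \<open>None\<close> need an argument: their condition is the density
  cocycle differentiated by the product rule.\<close>

lemma smooth_cocycle_cotractor: "smooth_cocycle A cotractor"
  unfolding smooth_cocycle_def
proof (intro conjI ballI allI)
  fix c x assume c: "c \<in> A" and x: "x \<in> cdom c"
  have "pd c a (density_transition c c) x = 0" for a
    using pd_cong[OF c open_cdom[OF c], of x "density_transition c c" "\<lambda>_. 1" a]
      x density_transition_refl[OF c] by simp
  then show "cotractor c c x = mat 1"
    using density_transition_refl[OF c x] tangent_refl[OF c x]
    by (auto simp: vec_eq_iff cotractor_def mat_def split: option.split)
next
  fix c d e x assume c: "c \<in> A" and d: "d \<in> A" and e: "e \<in> A" and x: "x \<in> cdom c \<inter> cdom d \<inter> cdom e"
  let ?t = density_transition
  have dif: "(?t a b \<circ> param e) differentiable at (coord e x)"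
    if "a \<in> A" "b \<in> A" "x \<in> cdom a" "x \<in> cdom b" for a b
    by (rule pd_change_chart(1)[OF atlas that(1) e _ smooth_in_differentiable[OF that(1)
          open_cdom[OF that(2)] _ smooth_in_density_transition[OF that(1,2)]]])
       (use that x in auto)
  have U: "open (cdom c \<inter> cdom d)" by (intro open_Int open_cdom c d)
  have "pd e a (?t c e) x = pd e a (\<lambda>z. ?t d e z * ?t c d z) x" for a
    by (rule pd_cong[OF e U]) (use x density_transition_cocycle[OF c d e] in auto)
  also have "\<dots> a = pd e a (?t d e) x * ?t c d x + ?t d e x * pd e a (?t c d) x" for a
    by (rule pd_mult) (use x c d e dif param_coord[OF atlas e] in auto)
  \<comment> \<open>The chain rule carries the derivative of the inner factor from \<open>e\<close>
    to \<open>d\<close>, the chart in which the entries of \<open>cotractor c d\<close> are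
    taken.\<close>
  also have "pd e a (?t c d) x = (\<Sum>b\<in>UNIV. tangent e d x $ b $ a * pd d b (?t c d) x)" for a
    by (rule pd_change_chart(2)[OF atlas d e _ density_differentiable[OF atlas c d]]) (use x in auto)
  finally have p: "pd e a (?t c e) x = pd e a (?t d e) x * ?t c d x
      + ?t d e x * (\<Sum>b\<in>UNIV. tangent e d x $ b $ a * pd d b (?t c d) x)" for a .
  have tan: "tangent e c x $ j $ i = (\<Sum>k\<in>UNIV. tangent d c x $ j $ k * tangent e d x $ k $ i)" for i j
    using tangent_cocycle[OF e d c, of x] x by (auto simp: vec_eq_iff matrix_matrix_mult_def)
  have "(cotractor d e x ** cotractor c d x) $ i $ j = cotractor c e x $ i $ j" for i j
    unfolding matrix_matrix_mult_def sum_UNIV_option cotractor_def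
    using density_transition_cocycle[OF c d e x, symmetric] p tan
    by (cases i; cases j) (simp_all add: sum_UNIV_option sum_distrib_left ac_simps)
  then show "cotractor d e x ** cotractor c d x = cotractor c e x" by (simp add: vec_eq_iff)
next
  fix c d i j assume c: "c \<in> A" and d: "d \<in> A"
  have o: "open (cdom d \<inter> cdom c)" by (intro open_Int open_cdom c d)
  note sw = smooth_in_swap[OF c d]
  have t: "smooth_in c (cdom d) (density_transition c d)"
    by (rule smooth_in_density_transition[OF c d])
  \<comment> \<open>This entry differentiates along the coordinates of \<open>d\<close>, while
    smoothness is required in \<open>c\<close>. The density transition is therefore moved to
    \<open>d\<close>, differentiated there, and the result is moved back by
    \<open>sw\<close>.\<close>
  have "smooth_in d (cdom d \<inter> cdom c) (density_transition c d)"
    by (rule smooth_in_change[OF c d o _ smooth_in_subset[OF t]]) auto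
  note pt = smooth_in_pd[OF d o this]
  have p: "smooth_in c (cdom d) (pd d a (density_transition c d))" for a
    by (rule sw, rule smooth_in_subset, rule pt) auto
  show "smooth_in c (cdom d) (\<lambda>x. cotractor c d x $ i $ j)"
    unfolding cotractor_def
    by (cases i; cases j)
       (simp_all add: t p sw smooth_in_tangent[OF d c] smooth_in_mult[OF c open_cdom[OF d]]
         smooth_in_const[OF c open_cdom[OF d]])
qed

lemma smooth_cocycle_mult:
  assumes "smooth_cocycle A E" "c \<in> A" "d \<in> A" "e \<in> A" "x \<in> cdom c" "x \<in> cdom d" "x \<in> cdom e"
  shows "E d e x ** E c d x = E c e x"
  using assms by (auto simp: smooth_cocycle_def)

lemma smooth_cocycle_inverse:
  assumes "smooth_cocycle A E" "c \<in> A" "d \<in> A" "x \<in> cdom c \<inter> cdom d"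
  shows "matrix_inv (E c d x) = E d c x"
proof -
  have 1: "E c d x ** E d c x = mat 1" "E d c x ** E c d x = mat 1"
    using smooth_cocycle_mult[OF assms(1)] assms by (auto simp: smooth_cocycle_def)
  then have "E c d x ** matrix_inv (E c d x) = mat 1"
    unfolding matrix_inv_def by (metis (mono_tags, lifting) someI_ex)
  with 1 show ?thesis by (metis matrix_mul_assoc matrix_mul_lid matrix_mul_rid)
qed

text \<open>Inverting a transition matrix swaps the charts. Inversion and transposition each reverse
  products, so together they restore the order in the cocycle condition.\<close>

lemma smooth_cocycle_dual:
  assumes E: "smooth_cocycle A E"
  shows "smooth_cocycle A (dual E)"
  unfolding smooth_cocycle_def
proof (intro conjI ballI allI)
  fix c x assume "c \<in> A" "x \<in> cdom c"
  then show "dual E c c x = mat 1"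
    using E smooth_cocycle_inverse[OF E, of c c x] by (simp add: dual_def smooth_cocycle_def)
next
  fix c d e x assume c: "c \<in> A" and d: "d \<in> A" and e: "e \<in> A" and x: "x \<in> cdom c \<inter> cdom d \<inter> cdom e"
  have "E d c x ** E e d x = E e c x"
    using smooth_cocycle_mult[OF E e d c] x by simp
  then show "dual E d e x ** dual E c d x = dual E c e x"
    using c d e x smooth_cocycle_inverse[OF E] by (simp add: dual_def flip: matrix_transpose_mul)
next
  fix c d i j assume c: "c \<in> A" and d: "d \<in> A"
  have "smooth_in c (cdom d) (\<lambda>x. E d c x $ j $ i)"
    by (rule smooth_in_swap[OF c d]) (use E c d in \<open>auto simp: smooth_cocycle_def\<close>)
  then show "smooth_in c (cdom d) (\<lambda>x. dual E c d x $ i $ j)"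
    by (rule smooth_in_cong[OF c open_cdom[OF d], rotated])
       (use smooth_cocycle_inverse[OF E c d] in \<open>auto simp: dual_def transpose_def\<close>)
qed

text \<open>Connections and curvature are specified by their effect on sections. This provides
  sections with prescribed components over one chart, in particular frame fields and constant
  vectors.\<close>

lemma section_extending_components:
  assumes E: "smooth_cocycle A E" and c: "c \<in> A" and U: "open U" "U \<subseteq> cdom c" and f: "smooth_in c U f"
  obtains s where "is_section A E U s" "s c = f"
proof
  \<comment> \<open>The case \<open>d = c\<close> is separated so that \<open>s c = f\<close> holds
    as an equation of functions, also at points where \<open>E c c\<close> is not known to be the
    identity.\<close>
  let ?s = "\<lambda>d. if d = c then f else (\<lambda>x. E c d x *v f x)"
  have s: "?s d x = E c d x *v f x" if "x \<in> U" for d x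
    using that E c U by (auto simp: smooth_cocycle_def)
  have sm: "smooth_in d U (?s d)" if d: "d \<in> A" for d
  proof (rule smooth_in_cong[OF d U(1)])
    let ?V = "U \<inter> cdom d"
    have V: "open ?V" using U open_cdom[OF d] by auto
    have fi: "smooth_in c ?V (\<lambda>x. f x $ i)" for i
      using smooth_in_component[OF c U(1), of f] f by (blast intro: smooth_in_subset)
    have Ei: "smooth_in c ?V (\<lambda>x. E c d x $ i $ j)" for i j
      by (rule smooth_in_subset[where U = "cdom d"]) (use E c d in \<open>auto simp: smooth_cocycle_def\<close>)
    have "smooth_in c ?V (\<lambda>x. E c d x *v f x)"
      unfolding smooth_in_component[OF c V] matrix_vector_mult_def vec_lambda_beta
      by (intro allI smooth_in_sum[OF c V] smooth_in_mult[OF c V] fi Ei) auto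
    then have "smooth_in d ?V (\<lambda>x. E c d x *v f x)"
      by (rule smooth_in_change[OF c d V, rotated]) (use U in auto)
    then show "smooth_in d U (\<lambda>x. E c d x *v f x)" by (rule smooth_in_subset) auto
  qed (use s in auto)
  have tr: "?s e x = E d e x *v ?s d x" if "d \<in> A" "e \<in> A" "x \<in> U \<inter> cdom d \<inter> cdom e" for d e x
  proof -
    have "E d e x ** E c d x = E c e x" using smooth_cocycle_mult[OF E c that(1,2)] that U by auto
    then show ?thesis using s[of x] that by (simp add: matrix_vector_mul_assoc)
  qed
  show "is_section A E U ?s" unfolding is_section_def using sm tr by blast
  show "?s c = f" by simp
qed

section \<open>Connections and curvature in a chart\<close>

lemma is_section_add:
  assumes U: "open U" and s: "is_section A E U s" and t: "is_section A E U t"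
  shows "is_section A E U (\<lambda>c z. s c z + t c z)"
  unfolding is_section_def
proof (intro conjI ballI)
  show "smooth_in c U (\<lambda>z. s c z + t c z)" if "c \<in> A" for c
    using that s t by (intro smooth_in_add[OF _ U]) (simp_all add: is_section_def)
  fix c d x assume "c \<in> A" "d \<in> A" "x \<in> U \<inter> cdom c \<inter> cdom d"
  then have "s d x = E c d x *v s c x" "t d x = E c d x *v t c x"
    using s t unfolding is_section_def by blast+
  then show "s d x + t d x = E c d x *v (s c x + t c x)"
    by (simp only: matrix_vector_right_distrib)
qed

lemma is_section_scaleR:
  assumes U: "open U" and s: "is_section A E U s" and f: "is_smooth_function A U f"
  shows "is_section A E U (\<lambda>c z. f z *\<^sub>R s c z)"
  unfolding is_section_def
proof (intro conjI ballI)
  show "smooth_in c U (\<lambda>z. f z *\<^sub>R s c z)" if "c \<in> A" for c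
    using that s f by (intro smooth_in_scaleR[OF _ U]) (simp_all add: is_section_def is_smooth_function_def)
  fix c d x assume "c \<in> A" "d \<in> A" "x \<in> U \<inter> cdom c \<inter> cdom d"
  then have "s d x = E c d x *v s c x" using s unfolding is_section_def by blast
  then show "f x *\<^sub>R s d x = E c d x *v (f x *\<^sub>R s c x)"
    by (simp only: matrix_vector_mult_scaleR)
qed

lemma is_smooth_functionI:
  assumes "c \<in> A" "open U" "U \<subseteq> cdom c" "smooth_in c U f"
  shows "is_smooth_function A U f"
  unfolding is_smooth_function_def using smooth_in_change[OF assms(1) _ assms(2) _ assms(4)] assms(3) by blast

lemma connection_add:
  assumes D: "is_connection A E D" and "open U" "is_section A E U s" "is_section A E U t" "c \<in> A" "x \<in> U \<inter> cdom c"
  shows "D c (\<lambda>z. s c z + t c z) x a = D c (s c) x a + D c (t c) x a"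
proof -
  note D[unfolded is_connection_def, THEN conjunct2, THEN conjunct2, THEN conjunct1, rule_format]
  then show ?thesis using assms by blast
qed

lemma connection_leibniz:
  assumes D: "is_connection A E D" and "open U" "is_section A E U s" "is_smooth_function A U f" "c \<in> A" "x \<in> U \<inter> cdom c"
  shows "D c (\<lambda>z. f z *\<^sub>R s c z) x a = pd c a f x *\<^sub>R s c x + f x *\<^sub>R D c (s c) x a"
proof -
  note D[unfolded is_connection_def, THEN conjunct2, THEN conjunct2, THEN conjunct2, rule_format]
  then show ?thesis using assms by blast
qed

text \<open>A section over part of a chart is a combination of the constant frame sections with
  smooth coefficients. Additivity and the Leibniz rule reduce its derivative to those of the
  frame.\<close>

lemma connection_in_chart:
  fixes D :: "('m, 'n, 'r::finite) cov"
  assumes D: "is_connection A E D" and E: "smooth_cocycle A E" and c: "c \<in> A"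
    and U: "open U" "U \<subseteq> cdom c" and f: "smooth_in c U f" and x: "x \<in> U"
  shows "D c f x a = pd c a f x + (\<Sum>b\<in>UNIV. f x $ b *\<^sub>R D c (\<lambda>_. axis b 1) x a)"
proof -
  have "\<exists>s. is_section A E U s \<and> s c = (\<lambda>_. axis b 1)" for b
    by (rule section_extending_components[OF E c U smooth_in_const[OF c U(1)]]) blast
  then obtain e where e: "\<And>b. is_section A E U (e b)" "\<And>b. e b c = (\<lambda>_. axis b 1)" by metis
  have fb: "smooth_in c U (\<lambda>z. f z $ b)" for b
    using f smooth_in_component[OF c U(1)] by blast
  have g: "is_smooth_function A U (\<lambda>z. f z $ b)" for b
    by (rule is_smooth_functionI[OF c U fb])
  have xU: "x \<in> U \<inter> cdom c" using x U by auto
  note leib = connection_leibniz[OF D U(1) e(1) _ c xU]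
  \<comment> \<open>Additivity applies to two sections at a time, so each partial sum is shown to be
    a section together with the formula for its derivative.\<close>
  define T where "T I = (\<lambda>d z. \<Sum>b\<in>I. f z $ b *\<^sub>R e b d z)" for I
  have T: "is_section A E U (T I) \<and> D c (T I c) x a = (\<Sum>b\<in>I. D c (\<lambda>z. f z $ b *\<^sub>R e b c z) x a)" for I
  proof (induction I rule: infinite_finite_induct)
    case empty
    \<comment> \<open>The zero section is a frame section times the zero function, so its derivative
      vanishes by the Leibniz rule.\<close>
    have 0: "is_smooth_function A U (\<lambda>_. 0)"
      by (rule is_smooth_functionI[OF c U smooth_in_const[OF c U(1)]])
    show ?case
      using is_section_scaleR[OF U(1) e(1) 0] leib[OF 0] by (simp add: T_def)
  next
    case (insert b I)
    have s: "is_section A E U (\<lambda>d z. f z $ b *\<^sub>R e b d z)"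
      by (rule is_section_scaleR[OF U(1) e(1) g])
    have T: "T (insert b I) = (\<lambda>d z. f z $ b *\<^sub>R e b d z + T I d z)"
      using insert by (simp add: T_def)
    have "D c (\<lambda>z. f z $ b *\<^sub>R e b c z + T I c z) x a =
        D c (\<lambda>z. f z $ b *\<^sub>R e b c z) x a + D c (T I c) x a"
      using connection_add[OF D U(1) s _ c xU] insert.IH by blast
    then show ?case
      using insert is_section_add[OF U(1) s, of "T I"] by (simp add: T)
  qed simp
  have "T UNIV c z = f z" for z
    by (simp add: T_def e(2) vec_eq_iff axis_def if_distrib cong: if_cong)
  then have "D c f x a = (\<Sum>b\<in>UNIV. D c (\<lambda>z. f z $ b *\<^sub>R e b c z) x a)"
    using T[of UNIV] by presburger
  also have "\<dots> = (\<Sum>b\<in>UNIV. pd c a (\<lambda>z. f z $ b) x *\<^sub>R axis b 1 + f x $ b *\<^sub>R D c (\<lambda>_. axis b 1) x a)"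
    using leib[OF g] by (simp add: e(2))
  also have "(\<Sum>b\<in>UNIV. pd c a (\<lambda>z. f z $ b) x *\<^sub>R axis b 1) = pd c a f x"
    by (simp add: vec_eq_iff axis_def if_distrib
        pd_component[OF smooth_in_differentiable[OF c U(1) xU f]] cong: if_cong)
  ultimately show ?thesis by (simp add: sum.distrib)
qed

lemma smooth_in_connection_coefficient:
  assumes D: "is_connection A E D" and E: "smooth_cocycle A E" and c: "c \<in> A"
  shows "smooth_in c (cdom c) (\<lambda>z. D c (\<lambda>_. axis b 1) z a)"
proof -
  note o = open_cdom[OF c]
  obtain s where "is_section A E (cdom c) s" "s c = (\<lambda>_. axis b 1)"
    by (rule section_extending_components[OF E c o subset_refl smooth_in_const[OF c o]]) blast
  with D o c show ?thesis unfolding is_connection_def by metis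
qed

text \<open>The curvature of a connection with matrix \<open>W\<close> is dW plus the wedge square
  of \<open>W\<close>. Symmetry of the Christoffel symbols cancels the correction for the form
  index. The hypothesis \<open>D\<close> is the local form in this one chart, so the lemma serves
  the affine and the tractor connection alike.\<close>

lemma curvature_in_chart:
  fixes D :: "('m, 'n, 'r::finite) cov" and W :: "'m \<Rightarrow> 'n \<Rightarrow> real^'r^'r"
  assumes E: "smooth_cocycle A E" and c: "c \<in> A" and x: "x \<in> cdom c"
    and N: "\<And>a b. christoffel N c x a b = christoffel N c x b a"
    and W: "\<And>a i j. smooth_in c (cdom c) (\<lambda>z. W z a $ i $ j)"
    and D: "\<And>U f z a. open U \<Longrightarrow> U \<subseteq> cdom c \<Longrightarrow> smooth_in c U f \<Longrightarrow> z \<in> U \<Longrightarrow>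
      D c f z a = pd c a f z + W z a *v f z"
  shows "curvature A E N D c x a b $ i $ j =
      pd c a (\<lambda>z. W z b $ i $ j) x - pd c b (\<lambda>z. W z a $ i $ j) x
      + (\<Sum>l\<in>UNIV. W x a $ i $ l * W x b $ l $ j - W x b $ i $ l * W x a $ l $ j)"
proof -
  define R where "R = (\<chi> i j. pd c a (\<lambda>z. W z b $ i $ j) x - pd c b (\<lambda>z. W z a $ i $ j) x
      + (\<Sum>l\<in>UNIV. W x a $ i $ l * W x b $ l $ j - W x b $ i $ l * W x a $ l $ j))"
  let ?P = "\<lambda>R. \<forall>U s. open U \<and> x \<in> U \<and> is_section A E U s \<longrightarrow>
     second_cov N D c (s c) x a b - second_cov N D c (s c) x b a = R *v s c x"
  have "?P R"
  proof (intro allI impI)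
    fix U s assume U: "open U \<and> x \<in> U \<and> is_section A E U s"
    define V where "V = U \<inter> cdom c"
    have V: "open V" "V \<subseteq> cdom c" "x \<in> V" "x \<in> V \<inter> cdom c"
      using U x open_Int[OF _ open_cdom[OF c]] by (auto simp: V_def)
    define f where "f = s c"
    have f: "smooth_in c V f"
      using U c by (auto simp: is_section_def f_def V_def intro: smooth_in_subset)
    have fi: "smooth_in c V (\<lambda>z. f z $ i)" for i
      using f smooth_in_component[OF c V(1)] by blast
    have WV: "smooth_in c V (\<lambda>z. W z a $ i $ j)" for a i j
      by (rule smooth_in_subset[OF W]) auto
    define h where "h b z = pd c b f z + W z b *v f z" for b z
    have hi: "h b z $ i = pd c b (\<lambda>y. f y $ i) z + (\<Sum>l\<in>UNIV. W z b $ i $ l * f z $ l)" if "z \<in> V" for b z i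
      using that V by (simp add: h_def matrix_vector_mult_def
          pd_component[OF smooth_in_differentiable[OF c V(1) _ f]] subset_iff)
    have hs: "smooth_in c V (\<lambda>z. pd c b (\<lambda>y. f y $ i) z + (\<Sum>l\<in>UNIV. W z b $ i $ l * f z $ l))" for b i
      by (intro smooth_in_add[OF c V(1)] smooth_in_pd[OF c V(1)] smooth_in_sum[OF c V(1)]
          smooth_in_mult[OF c V(1)] fi WV finite)
    have hsm: "smooth_in c V (h b)" for b
      unfolding smooth_in_component[OF c V(1)]
      by (intro allI smooth_in_cong[OF c V(1) _ hs]) (simp add: hi)
    have Df: "D c f z b = h b z" if "z \<in> V" for b z
      unfolding h_def by (rule D[OF V(1,2) f that])
    have Dsm: "smooth_in c V (\<lambda>z. D c f z b)" for b
      by (rule smooth_in_cong[OF c V(1) _ hsm]) (use Df in auto)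
    note df = smooth_in_differentiable[OF c V(1) V(4)]
    note pc = param_coord[OF atlas c x]
    \<comment> \<open>Under exchange of \<open>a\<close> and \<open>b\<close>, the second
      derivatives of \<open>f\<close> agree by \<open>comm\<close>, and the terms with first
      derivatives of \<open>f\<close> are symmetric as a whole. Only terms linear in the value of
      \<open>f\<close> survive in the commutator.\<close>
    have second: "D c (\<lambda>z. D c f z b) x a $ i =
        pd c a (pd c b (\<lambda>y. f y $ i)) x
        + (\<Sum>l\<in>UNIV. pd c a (\<lambda>z. W z b $ i $ l) x * f x $ l + W x b $ i $ l * pd c a (\<lambda>y. f y $ l) x)
        + (\<Sum>l\<in>UNIV. W x a $ i $ l * pd c b (\<lambda>y. f y $ l) x)
        + (\<Sum>j\<in>UNIV. (\<Sum>l\<in>UNIV. W x a $ i $ l * W x b $ l $ j) * f x $ j)" for a b i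
    proof -
      have "D c (\<lambda>z. D c f z b) x a $ i = pd c a (\<lambda>z. D c f z b) x $ i + (W x a *v h b x) $ i"
        using D[OF V(1,2) Dsm V(3)] Df[OF V(3)] by simp
      also have "pd c a (\<lambda>z. D c f z b) x $ i = pd c a (\<lambda>z. D c f z b $ i) x"
        by (rule pd_component[OF df[OF Dsm]])
      also have "\<dots> = pd c a (\<lambda>z. pd c b (\<lambda>y. f y $ i) z + (\<Sum>l\<in>UNIV. W z b $ i $ l * f z $ l)) x"
        by (rule pd_cong[OF c V(1) V(4)]) (use Df hi in auto)
      also have "\<dots> = pd c a (pd c b (\<lambda>y. f y $ i)) x + pd c a (\<lambda>z. \<Sum>l\<in>UNIV. W z b $ i $ l * f z $ l) x"
        by (intro pd_add df smooth_in_pd[OF c V(1)] fi smooth_in_sum[OF c V(1)]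
            smooth_in_mult[OF c V(1)] WV finite)
      also have "pd c a (\<lambda>z. \<Sum>l\<in>UNIV. W z b $ i $ l * f z $ l) x
          = (\<Sum>l\<in>UNIV. pd c a (\<lambda>z. W z b $ i $ l * f z $ l) x)"
        by (intro pd_sum df smooth_in_mult[OF c V(1)] fi WV)
      also have "\<dots> = (\<Sum>l\<in>UNIV. pd c a (\<lambda>z. W z b $ i $ l) x * f x $ l + W x b $ i $ l * pd c a (\<lambda>y. f y $ l) x)"
        by (intro sum.cong refl pd_mult pc df fi WV)
      also have "(W x a *v h b x) $ i = (\<Sum>l\<in>UNIV. W x a $ i $ l * pd c b (\<lambda>y. f y $ l) x)
          + (\<Sum>l\<in>UNIV. \<Sum>j\<in>UNIV. W x a $ i $ l * (W x b $ l $ j * f x $ j))"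
        by (simp add: matrix_vector_mult_def hi[OF V(3)] distrib_left sum.distrib sum_distrib_left)
      also have "(\<Sum>l\<in>UNIV. \<Sum>j\<in>UNIV. W x a $ i $ l * (W x b $ l $ j * f x $ j))
          = (\<Sum>j\<in>UNIV. (\<Sum>l\<in>UNIV. W x a $ i $ l * W x b $ l $ j) * f x $ j)"
        by (subst sum.swap) (simp add: sum_distrib_right mult.assoc)
      finally show ?thesis by simp
    qed
    have comm: "pd c a (pd c b (\<lambda>y. f y $ i)) x = pd c b (pd c a (\<lambda>y. f y $ i)) x" for i
      by (rule pd_commute[OF c V(1) V(4) fi])
    have "second_cov N D c f x a b - second_cov N D c f x b a
        = D c (\<lambda>z. D c f z b) x a - D c (\<lambda>z. D c f z a) x b"
      by (simp add: second_cov_def N[of a b])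
    also have "\<dots> = R *v f x"
      unfolding vec_eq_iff vector_minus_component second comm
      by (simp add: R_def matrix_vector_mult_def sum.distrib sum_subtractf algebra_simps)
    finally show "second_cov N D c (s c) x a b - second_cov N D c (s c) x b a = R *v s c x"
      by (simp add: f_def)
  qed
  \<comment> \<open>Uniqueness for the definite description: every vector is the value at
    \<open>x\<close> of a section that is constant in the chart.\<close>
  moreover have "R' = R" if "?P R'" for R'
  proof -
    have "R' *v v = R *v v" for v
    proof -
      note o = open_cdom[OF c]
      obtain s where s: "is_section A E (cdom c) s" "s c = (\<lambda>_. v)"
        by (rule section_extending_components[OF E c o subset_refl smooth_in_const[OF c o]]) blast
      have "open (cdom c) \<and> x \<in> cdom c \<and> is_section A E (cdom c) s" using s o x by blast
      then have "R' *v s c x = R *v s c x" using that \<open>?P R\<close> by metis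
      then show ?thesis by (simp add: s)
    qed
    then show ?thesis by (simp add: matrix_eq)
  qed
  ultimately have "curvature A E N D c x a b = R"
    unfolding curvature_def by (rule the_equality)
  then show ?thesis by (simp add: R_def)
qed

end


section \<open>Alternated traces\<close>

text \<open>The 3-cycle on \<open>p\<close>, \<open>q\<close>, \<open>r\<close> is even, so
  reindexing by it or by its square leaves the signed sum unchanged. The three equal sums add up to
  zero term by term.\<close>

lemma signed_sum_cyclic_zero:
  fixes h :: "(nat \<Rightarrow> nat) \<Rightarrow> real"
  assumes pqr: "p < m" "q < m" "r < m" "p \<noteq> q" "q \<noteq> r" "p \<noteq> r"
    and h: "\<And>\<pi> \<pi>' \<pi>''. \<pi>' p = \<pi> q \<Longrightarrow> \<pi>' q = \<pi> r \<Longrightarrow> \<pi>' r = \<pi> p \<Longrightarrow>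
        \<pi>'' p = \<pi> r \<Longrightarrow> \<pi>'' q = \<pi> p \<Longrightarrow> \<pi>'' r = \<pi> q \<Longrightarrow>
        (\<And>i. i \<notin> {p, q, r} \<Longrightarrow> \<pi>' i = \<pi> i \<and> \<pi>'' i = \<pi> i) \<Longrightarrow> h \<pi> + h \<pi>' + h \<pi>'' = 0"
  shows "(\<Sum>\<pi> | \<pi> permutes {..<m}. of_int (sign \<pi>) * h \<pi>) = 0"
proof -
  define \<gamma> where "\<gamma> = Transposition.transpose p q \<circ> Transposition.transpose q r"
  let ?S = "\<lambda>f. \<Sum>\<pi> | \<pi> permutes {..<m}. of_int (sign \<pi>) * f \<pi> :: real"
  have t: "Transposition.transpose p q permutes {..<m}" "Transposition.transpose q r permutes {..<m}"
    using pqr by (auto intro: permutes_swap_id)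
  then have g: "\<gamma> permutes {..<m}" unfolding \<gamma>_def by (intro permutes_compose)
  have pm: "permutation \<pi>" if "\<pi> permutes {..<m}" for \<pi>
    using that by (rule permutes_imp_permutation[OF finite_lessThan])
  have sg: "sign \<gamma> = 1"
    using pqr t by (simp add: \<gamma>_def sign_compose pm sign_swap_id)
  have shift: "?S f = ?S (\<lambda>\<pi>. f (\<pi> \<circ> \<gamma>))" for f
    by (subst sum_permutations_compose_right[OF g]) (simp add: sign_compose pm g sg)
  have "?S h + ?S (\<lambda>\<pi>. h (\<pi> \<circ> \<gamma>)) + ?S (\<lambda>\<pi>. h (\<pi> \<circ> \<gamma> \<circ> \<gamma>))
      = (\<Sum>\<pi> | \<pi> permutes {..<m}. of_int (sign \<pi>) * (h \<pi> + h (\<pi> \<circ> \<gamma>) + h (\<pi> \<circ> \<gamma> \<circ> \<gamma>)))"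
    by (simp add: sum.distrib distrib_left)
  also have "\<dots> = 0"
  proof (intro sum.neutral ballI)
    fix \<pi>
    have "h \<pi> + h (\<pi> \<circ> \<gamma>) + h (\<pi> \<circ> \<gamma> \<circ> \<gamma>) = 0"
      by (rule h) (use pqr in \<open>auto simp: \<gamma>_def Transposition.transpose_def\<close>)
    then show "of_int (sign \<pi>) * (h \<pi> + h (\<pi> \<circ> \<gamma>) + h (\<pi> \<circ> \<gamma> \<circ> \<gamma>)) = 0" by simp
  qed
  finally show ?thesis
    using shift[of h] shift[of "\<lambda>\<pi>. h (\<pi> \<circ> \<gamma>)"] by simp
qed

section \<open>The Bianchi identity and the wedge with the Schouten tensor\<close>

abbreviation kron :: "'n \<Rightarrow> 'n \<Rightarrow> real" where
  "kron a b \<equiv> (if a = b then 1 else 0)"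

lemma sum_kron:
  fixes y :: "'n::finite \<Rightarrow> real"
  shows "(\<Sum>k\<in>UNIV. kron a k * y k) = y a" "(\<Sum>k\<in>UNIV. kron k a * y k) = y a"
    "(\<Sum>k\<in>UNIV. y k * kron a k) = y a" "(\<Sum>k\<in>UNIV. y k * kron k a) = y a"
    "(\<Sum>k\<in>UNIV. kron a k) = 1" "(\<Sum>k\<in>UNIV. kron k a) = 1"
proof -
  have "kron a k * y k = (if a = k then y k else 0)" "kron k a * y k = (if k = a then y k else 0)"
    "y k * kron a k = (if a = k then y k else 0)" "y k * kron k a = (if k = a then y k else 0)" for k by simp_all
  then show "(\<Sum>k\<in>UNIV. kron a k * y k) = y a" "(\<Sum>k\<in>UNIV. kron k a * y k) = y a"
    "(\<Sum>k\<in>UNIV. y k * kron a k) = y a" "(\<Sum>k\<in>UNIV. y k * kron k a) = y a"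
    by (simp_all only: sum.delta sum.delta' finite UNIV_I if_True)
qed simp_all

definition bianchi :: "('n \<Rightarrow> 'n \<Rightarrow> real^'n::finite^'n) \<Rightarrow> bool" where
  "bianchi X \<longleftrightarrow> (\<forall>a b c d. X a b $ c $ d + X b d $ c $ a + X d a $ c $ b = 0)"

definition schouten_wedge :: "('n \<Rightarrow> 'n \<Rightarrow> real) \<Rightarrow> 'n \<Rightarrow> 'n \<Rightarrow> real^'n::finite^'n" where
  "schouten_wedge P a b = (\<chi> c d. kron a c * P b d - kron b c * P a d)"

text \<open>The Kronecker symbol in the wedge moves one of its form indices into the lower slot of
  \<open>X\<close>. Skewing over that index and the two form indices of \<open>X\<close> produces
  the cyclic sum, which vanishes; by \<open>M\<close>, the remaining factors do not see these
  positions.\<close>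

lemma signed_sum_bianchi_wedge:
  fixes X :: "'n::finite \<Rightarrow> 'n \<Rightarrow> real^'n^'n" and M :: "(nat \<Rightarrow> nat) \<Rightarrow> real^'n^'n" and a :: "nat \<Rightarrow> 'n"
  assumes X: "bianchi X" and d: "p < m" "q < m" "r < m" "s < m" "distinct [p, q, r, s]"
    and M: "\<And>\<pi> \<pi>'. (\<And>i. i \<notin> {p, q, r, s} \<Longrightarrow> \<pi> i = \<pi>' i) \<Longrightarrow> M \<pi> = M \<pi>'"
  shows "(\<Sum>\<pi> | \<pi> permutes {..<m}. of_int (sign \<pi>) *
      trace (M \<pi> ** (X (a (\<pi> p)) (a (\<pi> q)) ** schouten_wedge P (a (\<pi> r)) (a (\<pi> s))))) = 0"
proof -
  \<comment> \<open>The two summands of the wedge contribute \<open>h r s\<close> and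
    \<open>- h s r\<close>: the first position goes into \<open>X\<close>, the second into
    \<open>P\<close>.\<close>
  define h where "h r s \<pi> = (\<Sum>i\<in>UNIV. \<Sum>c\<in>UNIV.
      M \<pi> $ i $ c * X (a (\<pi> p)) (a (\<pi> q)) $ c $ (a (\<pi> r)) * P (a (\<pi> s)) i)" for r s and \<pi> :: "nat \<Rightarrow> nat"
  have z: "(\<Sum>\<pi> | \<pi> permutes {..<m}. of_int (sign \<pi>) * h r' s' \<pi>) = 0"
    if rs: "(r', s') \<in> {(r, s), (s, r)}" for r' s'
  proof (rule signed_sum_cyclic_zero[of p m q r'])
    fix \<pi> \<pi>' \<pi>'' :: "nat \<Rightarrow> nat"
    assume e: "\<pi>' p = \<pi> q" "\<pi>' q = \<pi> r'" "\<pi>' r' = \<pi> p" "\<pi>'' p = \<pi> r'" "\<pi>'' q = \<pi> p" "\<pi>'' r' = \<pi> q"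
      and f: "\<And>i. i \<notin> {p, q, r'} \<Longrightarrow> \<pi>' i = \<pi> i \<and> \<pi>'' i = \<pi> i"
    have s: "\<pi>' s' = \<pi> s'" "\<pi>'' s' = \<pi> s'" using f[of s'] rs d by auto
    have MM: "M \<pi>' = M \<pi>" "M \<pi>'' = M \<pi>" by (intro M; use f rs in auto)+
    have "h r' s' \<pi> + h r' s' \<pi>' + h r' s' \<pi>'' = (\<Sum>i\<in>UNIV. \<Sum>c\<in>UNIV. M \<pi> $ i $ c * P (a (\<pi> s')) i *
        (X (a (\<pi> p)) (a (\<pi> q)) $ c $ (a (\<pi> r')) + X (a (\<pi> q)) (a (\<pi> r')) $ c $ (a (\<pi> p))
          + X (a (\<pi> r')) (a (\<pi> p)) $ c $ (a (\<pi> q))))"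
      unfolding h_def e s MM sum.distrib[symmetric] by (simp add: algebra_simps)
    also have "\<dots> = 0" using X by (simp add: bianchi_def)
    finally show "h r' s' \<pi> + h r' s' \<pi>' + h r' s' \<pi>'' = 0" .
  qed (use rs d in auto)
  have "trace (M \<pi> ** (X (a (\<pi> p)) (a (\<pi> q)) ** schouten_wedge P (a (\<pi> r)) (a (\<pi> s))))
      = h r s \<pi> - h s r \<pi>" for \<pi>
  proof -
    have "(X b c ** schouten_wedge P f g) $ i $ j = X b c $ i $ f * P g j - X b c $ i $ g * P f j" for b c f g i j
    proof -
      have "(X b c ** schouten_wedge P f g) $ i $ j =
          (\<Sum>k\<in>UNIV. kron f k * (X b c $ i $ k * P g j) - kron g k * (X b c $ i $ k * P f j))"
        unfolding matrix_matrix_mult_def schouten_wedge_def vec_lambda_beta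
        by (rule sum.cong) (simp_all only: algebra_simps)
      then show ?thesis by (simp only: sum_subtractf sum_kron)
    qed
    then show ?thesis
      by (simp add: trace_def matrix_matrix_mult_def[of "M \<pi>"] h_def right_diff_distrib sum_subtractf mult.assoc)
  qed
  then show ?thesis using z by (simp add: right_diff_distrib sum_subtractf)
qed

text \<open>The factor may depend on its place in the list, so that factors can be exchanged one at
  a time.\<close>

definition chain_product ::
  "(nat \<Rightarrow> 'n \<Rightarrow> 'n \<Rightarrow> real^'r::finite^'r) \<Rightarrow> (nat \<Rightarrow> 'n) \<Rightarrow> nat list \<Rightarrow> real^'r^'r" where
  "chain_product F b ns = foldr (\<lambda>i M. F i (b (2 * i)) (b (2 * i + 1)) ** M) ns (mat 1)"

lemma chain_product_Nil [simp]: "chain_product F b [] = mat 1"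
  and chain_product_Cons [simp]:
    "chain_product F b (i # ns) = F i (b (2 * i)) (b (2 * i + 1)) ** chain_product F b ns"
  by (simp_all add: chain_product_def)

lemma chain_product_append:
  "chain_product F b (ns @ ms) = chain_product F b ns ** chain_product F b ms"
  by (induction ns) (simp_all add: matrix_mul_lid matrix_mul_assoc)

lemma chain_product_cong:
  assumes "\<And>i. i \<in> set ns \<Longrightarrow> F i = F' i"
    and "\<And>i. i \<in> set ns \<Longrightarrow> b (2 * i) = b' (2 * i) \<and> b (2 * i + 1) = b' (2 * i + 1)"
  shows "chain_product F b ns = chain_product F' b' ns"
  using assms by (induction ns) simp_all

lemma skew_trace_chain_product:
  "skew_trace k F a = (\<Sum>\<pi> | \<pi> permutes {..<2 * k}. of_int (sign \<pi>) *
     trace (chain_product (\<lambda>_. F) (a \<circ> \<pi>) [0..<k])) / fact (2 * k)"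
  by (simp add: skew_trace_def chain_product_def)

lemma matrix_add_rdistrib:
  fixes A B C :: "real^'n::finite^'n"
  shows "(A + B) ** C = A ** C + B ** C"
  by (simp add: vec_eq_iff matrix_matrix_mult_def distrib_right sum.distrib)

lemma bianchi_schouten_wedge:
  assumes "\<And>a b. P a b = P b a"
  shows "bianchi (schouten_wedge P)"
  unfolding bianchi_def schouten_wedge_def using assms by (simp add: algebra_simps)

text \<open>Replacing one curvature factor by its Weyl part changes the alternated trace by a term in which
  \<open>schouten_wedge P\<close> is cyclically preceded by a factor satisfying the Bianchi identity; as
  \<open>schouten_wedge P a b\<close> is the wedge of \<open>dx\<^sup>c\<close> with \<open>P\<^sub>d\<close>, such a term vanishes.\<close>

lemma skew_trace_add_wedge:
  fixes F W :: "'n::finite \<Rightarrow> 'n \<Rightarrow> real^'n^'n"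
  assumes k: "k > 0" and W: "bianchi W" and P: "\<And>a b. P a b = P b a"
    and F: "\<And>a b. F a b = W a b + schouten_wedge P a b"
  shows "skew_trace k F a = skew_trace k W a"
proof (cases "k = 1")
  case True
  \<comment> \<open>With a single factor nothing precedes the wedge, but its trace
    \<open>P c b - P b c\<close> is zero by symmetry.\<close>
  have "trace (F b c) = trace (W b c)" for b c
    using P[of b c] by (simp only: F trace_add) (simp only: trace_def schouten_wedge_def vec_lambda_beta sum_subtractf sum_kron)
  then show ?thesis by (simp add: True skew_trace_def matrix_mul_rid)
next
  case False
  have bF: "bianchi F"
    unfolding bianchi_def F
  proof (intro allI)
    fix a b c d
    have "W a b $ c $ d + W b d $ c $ a + W d a $ c $ b = 0"
      "schouten_wedge P a b $ c $ d + schouten_wedge P b d $ c $ a + schouten_wedge P d a $ c $ b = 0"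
      using W bianchi_schouten_wedge[of P, OF P] unfolding bianchi_def by blast+
    then show "(W a b + schouten_wedge P a b) $ c $ d + (W b d + schouten_wedge P b d) $ c $ a
        + (W d a + schouten_wedge P d a) $ c $ b = 0" by simp
  qed
  \<comment> \<open>\<open>G j\<close> has \<open>F\<close> in the first \<open>j\<close> places and
    \<open>W\<close> in the others, so \<open>T\<close> interpolates between the sums for
    \<open>W\<close> at \<open>0\<close> and for \<open>F\<close> at \<open>k\<close>.\<close>
  define G where "G j i = (if i < j then F else W)" for j i :: nat
  have bG: "bianchi (G j i)" for j i using W bF by (simp add: G_def)
  define T where "T j = (\<Sum>\<pi> | \<pi> permutes {..<2 * k}. of_int (sign \<pi>) *
     trace (chain_product (G j) (a \<circ> \<pi>) [0..<k]))" for j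
  have step: "T (Suc j) = T j" if j: "j < k" for j
  proof -
    let ?c = "\<lambda>ns \<pi>. chain_product (G j) (a \<circ> \<pi>) ns"
    let ?\<theta> = "\<lambda>\<pi>. schouten_wedge P (a (\<pi> (2 * j))) (a (\<pi> (2 * j + 1)))"
    have split: "[0..<k] = [0..<j] @ j # [Suc j..<k]"
      using upt_add_eq_append[of 0 j "k - j"] upt_conv_Cons[OF j] j by simp
    have c1: "chain_product (G (Suc j)) (a \<circ> \<pi>) [0..<j] = ?c [0..<j] \<pi>" for \<pi>
      by (rule chain_product_cong) (auto simp: G_def)
    have c2: "chain_product (G (Suc j)) (a \<circ> \<pi>) [Suc j..<k] = ?c [Suc j..<k] \<pi>" for \<pi>
      by (rule chain_product_cong) (auto simp: G_def)
    have agree: "?c ns \<pi> = ?c ns \<pi>'"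
      if *: "\<And>l. l \<notin> {2 * i, 2 * i + 1, 2 * j, 2 * j + 1} \<Longrightarrow> \<pi> l = \<pi>' l" and "i \<notin> set ns" "j \<notin> set ns"
      for i ns \<pi> \<pi>'
    proof (rule chain_product_cong)
      fix l assume "l \<in> set ns"
      then have "l \<noteq> i" "l \<noteq> j" using that by auto
      then have "\<pi> (2 * l) = \<pi>' (2 * l)" "\<pi> (2 * l + 1) = \<pi>' (2 * l + 1)"
        by (intro *; simp; presburger)+
      then show "(a \<circ> \<pi>) (2 * l) = (a \<circ> \<pi>') (2 * l) \<and> (a \<circ> \<pi>) (2 * l + 1) = (a \<circ> \<pi>') (2 * l + 1)"
        by simp
    qed simp
    \<comment> \<open>The two products differ by the wedge at place \<open>j\<close>; cyclicity of
      the trace moves that wedge to the end.\<close>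
    have "trace (chain_product (G (Suc j)) (a \<circ> \<pi>) [0..<k]) - trace (chain_product (G j) (a \<circ> \<pi>) [0..<k])
        = trace (?c [Suc j..<k] \<pi> ** ?c [0..<j] \<pi> ** ?\<theta> \<pi>)" for \<pi>
    proof -
      have "trace (chain_product (G (Suc j)) (a \<circ> \<pi>) [0..<k]) - trace (chain_product (G j) (a \<circ> \<pi>) [0..<k])
          = trace (?c [0..<j] \<pi> ** (?\<theta> \<pi> ** ?c [Suc j..<k] \<pi>))"
        unfolding split chain_product_append chain_product_Cons c1 c2
        by (simp add: G_def F matrix_add_rdistrib matrix_add_ldistrib trace_add)
      also have "\<dots> = trace (?c [Suc j..<k] \<pi> ** ?c [0..<j] \<pi> ** ?\<theta> \<pi>)"
        by (metis matrix_mul_assoc trace_mul_sym)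
      finally show ?thesis .
    qed
    then have "T (Suc j) - T j = (\<Sum>\<pi> | \<pi> permutes {..<2 * k}. of_int (sign \<pi>) *
        trace (?c [Suc j..<k] \<pi> ** ?c [0..<j] \<pi> ** ?\<theta> \<pi>))"
      by (simp add: T_def sum_subtractf[symmetric] right_diff_distrib[symmetric])
    also have "\<dots> = 0"
    proof (cases j)
      case 0
      \<comment> \<open>Cyclically, the factor at place \<open>0\<close> is preceded by the last
        one, at place \<open>k - 1\<close>; the two places differ because \<open>k\<close> is at
        least 2 here.\<close>
      have "[Suc j..<k] = [Suc j..<k - 1] @ [k - 1]"
        using False k 0 by (cases k) auto
      then have e: "?c [Suc j..<k] \<pi> ** ?c [0..<j] \<pi> ** ?\<theta> \<pi> = ?c [Suc j..<k - 1] \<pi> **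
          (G j (k - 1) (a (\<pi> (2 * (k - 1)))) (a (\<pi> (2 * (k - 1) + 1))) ** ?\<theta> \<pi>)" for \<pi>
        by (simp add: 0 chain_product_append matrix_mul_rid flip: matrix_mul_assoc)
      show ?thesis unfolding e
      proof (rule signed_sum_bianchi_wedge[OF bG])
        show "?c [Suc j..<k - 1] \<pi> = ?c [Suc j..<k - 1] \<pi>'"
          if "\<And>i. i \<notin> {2 * (k - 1), 2 * (k - 1) + 1, 2 * j, 2 * j + 1} \<Longrightarrow> \<pi> i = \<pi>' i" for \<pi> \<pi>'
          by (rule agree[OF that]) (use 0 in auto)
      qed (use 0 False k in auto)
    next
      case (Suc i)
      have e: "?c [Suc j..<k] \<pi> ** ?c [0..<j] \<pi> ** ?\<theta> \<pi> = (?c [Suc j..<k] \<pi> ** ?c [0..<i] \<pi>) **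
          (G j i (a (\<pi> (2 * i))) (a (\<pi> (2 * i + 1))) ** ?\<theta> \<pi>)" for \<pi>
        by (simp add: Suc chain_product_append matrix_mul_rid matrix_mul_assoc)
      show ?thesis unfolding e
      proof (rule signed_sum_bianchi_wedge[OF bG])
        show "?c [Suc j..<k] \<pi> ** ?c [0..<i] \<pi> = ?c [Suc j..<k] \<pi>' ** ?c [0..<i] \<pi>'"
          if *: "\<And>l. l \<notin> {2 * i, 2 * i + 1, 2 * j, 2 * j + 1} \<Longrightarrow> \<pi> l = \<pi>' l" for \<pi> \<pi>' using agree[where ns = "[Suc j..<k]", OF *] agree[where ns = "[0..<i]", OF *] Suc by simp
      qed (use Suc j in auto)
    qed
    finally show ?thesis by simp
  qed
  have "T j = T 0" if "j \<le> k" for j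
    using that by (induction j) (auto simp: step)
  from this[OF order_refl] have "T k = T 0" .
  moreover have "chain_product (G k) b [0..<k] = chain_product (\<lambda>_. F) b [0..<k]" for b
    by (rule chain_product_cong) (auto simp: G_def)
  moreover have "chain_product (G 0) b [0..<k] = chain_product (\<lambda>_. W) b [0..<k]" for b
    by (rule chain_product_cong) (auto simp: G_def)
  ultimately show ?thesis by (simp add: skew_trace_chain_product T_def)
qed

text \<open>As the column \<open>None\<close> vanishes, the remaining diagonal blocks multiply among
  themselves. The entry at \<open>None\<close> of a product vanishes once there is a factor; for
  \<open>k = 0\<close> the identity matrices would have different traces.\<close>

lemma skew_trace_block:
  fixes F :: "'n \<Rightarrow> 'n \<Rightarrow> real^('r::finite option)^('r option)" and W :: "'n \<Rightarrow> 'n \<Rightarrow> real^'r^'r"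
  assumes k: "k > 0"
    and W: "\<And>a b c d. F a b $ Some c $ Some d = W a b $ c $ d"
    and z: "\<And>a b i. F a b $ i $ None = 0"
  shows "skew_trace k F a = skew_trace k W a"
proof -
  have 1: "chain_product (\<lambda>_. F) b ns $ Some c $ Some d = chain_product (\<lambda>_. W) b ns $ c $ d" for b ns c d
    by (induction ns arbitrary: c) (simp_all add: mat_def matrix_matrix_mult_def sum_UNIV_option W z)
  have 2: "chain_product (\<lambda>_. F) b ns $ None $ None = 0" if "ns \<noteq> []" for b ns
  proof -
    have "chain_product (\<lambda>_. F) b ns $ Some c $ None = 0" for c ns
      by (induction ns arbitrary: c) (simp_all add: mat_def matrix_matrix_mult_def sum_UNIV_option z)
    then show ?thesis using that
      by (cases ns) (simp_all add: matrix_matrix_mult_def sum_UNIV_option z)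
  qed
  have "trace (chain_product (\<lambda>_. F) b [0..<k]) = trace (chain_product (\<lambda>_. W) b [0..<k])" for b
    using k by (simp add: trace_def sum_UNIV_option 1 2)
  then show ?thesis by (simp add: skew_trace_chain_product)
qed


section \<open>Thomas symbols and the projective change of curvature\<close>

text \<open>Connection coefficients \<open>G\<close> at a point and their derivatives
  \<open>dG\<close> are treated as independent data, which turns the curvature identities into pure
  algebra. The arguments \<open>i\<close> and \<open>j\<close> are the upper and the lower matrix
  index.\<close>

definition riemann_of ::
  "('n::finite \<Rightarrow> 'n \<Rightarrow> 'n \<Rightarrow> real) \<Rightarrow> ('n \<Rightarrow> 'n \<Rightarrow> 'n \<Rightarrow> 'n \<Rightarrow> real) \<Rightarrow> 'n \<Rightarrow> 'n \<Rightarrow> 'n \<Rightarrow> 'n \<Rightarrow> real" where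
  "riemann_of G dG a b i j =
     dG a b j i - dG b a j i + (\<Sum>e\<in>UNIV. G a e i * G b j e - G b e i * G a j e)"

definition ricci_of :: "('n::finite \<Rightarrow> 'n \<Rightarrow> 'n \<Rightarrow> 'n \<Rightarrow> real) \<Rightarrow> 'n \<Rightarrow> 'n \<Rightarrow> real" where
  "ricci_of R a b = (\<Sum>i\<in>UNIV. R i a i b)"

text \<open>The solution of the defining equations of the Schouten tensor for the index pairs
  \<open>a b\<close> and \<open>b a\<close>.\<close>

definition schouten_of :: "('n::finite \<Rightarrow> 'n \<Rightarrow> real) \<Rightarrow> 'n \<Rightarrow> 'n \<Rightarrow> real" where
  "schouten_of Ric a b = (real CARD('n) * Ric a b + Ric b a) / ((real CARD('n))\<^sup>2 - 1)"

text \<open>\<open>Q a b\<close> is the covariant derivative of \<open>u\<close> minus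
  \<open>u a * u b\<close>. Since \<open>du\<close> may have a skew part, the term in
  \<open>kron i j\<close> remains.\<close>

lemma riemann_of_projective_change:
  fixes G :: "'n::finite \<Rightarrow> 'n \<Rightarrow> 'n \<Rightarrow> real" and u :: "'n \<Rightarrow> real" and du :: "'n \<Rightarrow> 'n \<Rightarrow> real"
  assumes G: "\<And>a b d. G a b d = G b a d"
  defines "Q \<equiv> \<lambda>a b. du a b - (\<Sum>e\<in>UNIV. G a b e * u e) - u a * u b"
  shows "riemann_of (\<lambda>a b d. G a b d + u a * kron b d + u b * kron a d)
      (\<lambda>e a b d. dG e a b d + du e a * kron b d + du e b * kron a d) a b i j =
    riemann_of G dG a b i j - kron a i * Q b j + kron b i * Q a j + (Q a b - Q b a) * kron i j"
proof -
  \<comment> \<open>Every Kronecker symbol carrying the summation index is contracted; the summands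
    symmetric in \<open>a\<close> and \<open>b\<close> then drop out of the curvature.\<close>
  have p: "(\<Sum>e\<in>UNIV. (G a e i + u a * kron e i + u e * kron a i) * (G b j e + u b * kron j e + u j * kron b e))
      = (\<Sum>e\<in>UNIV. G a e i * G b j e) + u b * G a j i + u j * G a b i + u a * G b j i + u a * u b * kron j i
        + u a * u j * kron b i + kron a i * (\<Sum>e\<in>UNIV. G b j e * u e) + 2 * (kron a i * u j * u b)" for a b
  proof -
    have "(G a e i + u a * kron e i + u e * kron a i) * (G b j e + u b * kron j e + u j * kron b e)
      = G a e i * G b j e + kron j e * (u b * G a e i) + kron b e * (u j * G a e i) + kron e i * (u a * G b j e)
        + kron e i * (u a * u b * kron j e) + kron e i * (u a * u j * kron b e) + kron a i * (G b j e * u e)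
        + kron j e * (kron a i * u e * u b) + kron b e * (kron a i * u e * u j)" for e
      by (simp only: algebra_simps)
    then show ?thesis
      by (simp only: sum.distrib sum_kron sum_distrib_left[symmetric]) (simp only: algebra_simps mult_2_right)
  qed
  have k: "kron j i = kron i j" by auto
  show ?thesis
    unfolding riemann_of_def sum_subtractf p Q_def G[of b a] k
    by (simp only: algebra_simps)
qed

lemma ricci_of_projective_change:
  fixes R :: "'n::finite \<Rightarrow> 'n \<Rightarrow> 'n \<Rightarrow> 'n \<Rightarrow> real"
  assumes "\<And>a b i j. R' a b i j = R a b i j - kron a i * Q b j + kron b i * Q a j + (Q a b - Q b a) * kron i j"
  shows "ricci_of R' a b = ricci_of R a b - real CARD('n) * Q a b + Q b a"
proof -
  have "ricci_of R' a b = (\<Sum>i\<in>UNIV. R i a i b - Q a b + kron a i * Q i b + kron i b * (Q i a - Q a i))"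
    unfolding ricci_of_def assms by (intro sum.cong) simp_all
  then show ?thesis
    by (simp only: sum.distrib sum_subtractf sum_kron ricci_of_def) simp
qed

text \<open>The Ricci tensor loses n times \<open>Q a b\<close> minus \<open>Q b a\<close>, and
  \<open>schouten_of\<close> inverts precisely this combination.\<close>

lemma schouten_of_projective_change:
  fixes R :: "'n::finite \<Rightarrow> 'n \<Rightarrow> 'n \<Rightarrow> 'n \<Rightarrow> real"
  assumes n: "CARD('n) \<ge> 2"
    and R: "\<And>a b i j. R' a b i j = R a b i j - kron a i * Q b j + kron b i * Q a j + (Q a b - Q b a) * kron i j"
  shows "schouten_of (ricci_of R') a b = schouten_of (ricci_of R) a b - Q a b"
proof -
  let ?n = "real CARD('n)"
  have "?n\<^sup>2 \<ge> 2\<^sup>2" using n by (intro power_mono) simp_all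
  then have nz: "?n\<^sup>2 - 1 \<noteq> 0" by simp
  have "?n * (ricci_of R a b - ?n * Q a b + Q b a) + (ricci_of R b a - ?n * Q b a + Q a b)
      = ?n * ricci_of R a b + ricci_of R b a - (?n\<^sup>2 - 1) * Q a b"
    by (simp add: algebra_simps power2_eq_square)
  then show ?thesis
    unfolding schouten_of_def ricci_of_projective_change[OF R] using nz by (simp only: diff_divide_distrib) simp
qed

text \<open>Vanishing traces leave a divergence and a quadratic term. The divergence inherits the
  symmetry of \<open>dG\<close>; the quadratic term is symmetric by exchange of its summation
  indices.\<close>

lemma ricci_of_symmetric:
  assumes G: "\<And>a b d. G a b d = G b a d" and dG: "\<And>e a b d. dG e a b d = dG e b a d"
    and tr: "\<And>b. (\<Sum>i\<in>UNIV. G i b i) = 0" and dtr: "\<And>a b. (\<Sum>i\<in>UNIV. dG a i b i) = 0"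
  shows "ricci_of (riemann_of G dG) a b = ricci_of (riemann_of G dG) b a"
proof -
  have "ricci_of (riemann_of G dG) a b =
      (\<Sum>i\<in>UNIV. dG i a b i) - (\<Sum>i\<in>UNIV. \<Sum>e\<in>UNIV. G a e i * G b i e)" for a b
  proof -
    have "(\<Sum>i\<in>UNIV. \<Sum>e\<in>UNIV. G i e i * G a b e) = (\<Sum>e\<in>UNIV. (\<Sum>i\<in>UNIV. G i e i) * G a b e)"
      by (subst sum.swap) (simp add: sum_distrib_right)
    then show ?thesis
      by (simp add: ricci_of_def riemann_of_def sum.distrib sum_subtractf dtr tr G[of _ b])
  qed
  moreover have "(\<Sum>i\<in>UNIV. \<Sum>e\<in>UNIV. G a e i * G b i e) = (\<Sum>i\<in>UNIV. \<Sum>e\<in>UNIV. G b e i * G a i e)"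
    by (subst sum.swap) (simp add: mult.commute)
  ultimately show ?thesis by (simp add: dG[of _ a b])
qed

text \<open>Symmetry in the lower indices makes the derivative terms and the quadratic terms cancel
  in pairs.\<close>

lemma riemann_of_bianchi:
  assumes G: "\<And>a b d. G a b d = G b a d" and dG: "\<And>e a b d. dG e a b d = dG e b a d"
  shows "riemann_of G dG a b i j + riemann_of G dG b j i a + riemann_of G dG j a i b = 0"
  unfolding riemann_of_def sum_subtractf
  by (simp add: G[of j a] G[of b a] G[of j b] dG[of _ j a] dG[of _ b a] dG[of _ j b])

section \<open>Thomas symbols of a connection in a chart\<close>

definition thomas :: "('m, 'n::finite, 'n) cov \<Rightarrow> ('m, 'n) chart \<Rightarrow> 'm \<Rightarrow> 'n \<Rightarrow> 'n \<Rightarrow> 'n \<Rightarrow> real" where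
  "thomas N c z a b d = christoffel N c z a b $ d - density_form N c z a * kron b d - density_form N c z b * kron a d"

definition chart_riemann :: "('m, 'n::finite) chart \<Rightarrow> ('m \<Rightarrow> 'n \<Rightarrow> 'n \<Rightarrow> 'n \<Rightarrow> real)
    \<Rightarrow> 'm \<Rightarrow> 'n \<Rightarrow> 'n \<Rightarrow> 'n \<Rightarrow> 'n \<Rightarrow> real" where
  "chart_riemann c K x = riemann_of (K x) (\<lambda>e a b d. pd c e (\<lambda>z. K z a b d) x)"

definition chart_schouten :: "('m, 'n::finite) chart \<Rightarrow> ('m \<Rightarrow> 'n \<Rightarrow> 'n \<Rightarrow> 'n \<Rightarrow> real)
    \<Rightarrow> 'm \<Rightarrow> 'n \<Rightarrow> 'n \<Rightarrow> real" where
  "chart_schouten c K x = schouten_of (ricci_of (chart_riemann c K x))"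

text \<open>The tensor \<open>Q\<close> of \<open>riemann_of_projective_change\<close> with the
  Thomas symbols as \<open>G\<close> and the density form as \<open>u\<close>.\<close>

definition schouten_shift :: "('m, 'n::finite, 'n) cov \<Rightarrow> ('m, 'n) chart \<Rightarrow> 'm \<Rightarrow> 'n \<Rightarrow> 'n \<Rightarrow> real" where
  "schouten_shift N c x a b = pd c a (\<lambda>z. density_form N c z b) x
     - (\<Sum>e\<in>UNIV. thomas N c x a b e * density_form N c x e) - density_form N c x a * density_form N c x b"

lemma schouten_eq_schouten_of:
  fixes N :: "('m::topological_space, 'n::finite) chart \<Rightarrow> ('m \<Rightarrow> real^'n) \<Rightarrow> 'm \<Rightarrow> 'n \<Rightarrow> real^'n"
  assumes n: "CARD('n) \<ge> 2"
  shows "schouten A N c x a b = schouten_of (ricci A N c x) a b"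
proof -
  let ?n = "real CARD('n)" and ?P = "schouten A N c x" and ?R = "ricci A N c x"
  have e: "?n * ?P a b = ?R a b + ?P b a" for a b
  proof -
    have "schouten_beta ?P a b = ?P b a - ?P a b" by (simp add: schouten_beta_def)
    then show ?thesis using schouten_eq[OF n, of A N c x a b] by (simp add: algebra_simps)
  qed
  have "?n\<^sup>2 \<ge> 2\<^sup>2" using n by (intro power_mono) simp_all
  then have nz: "?n\<^sup>2 - 1 \<noteq> 0" by simp
  have "?n * (?n * ?P a b) = ?n * ?R a b + (?R b a + ?P a b)"
    unfolding e[of a b] distrib_left e[of b a] ..
  then have "(?n\<^sup>2 - 1) * ?P a b = ?n * ?R a b + ?R b a"
    by (simp add: algebra_simps power2_eq_square)
  then show ?thesis using nz by (simp add: schouten_of_def field_simps)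
qed

context
  fixes A :: "('m::{t2_space,second_countable_topology}, 'n::finite) chart set"
    and N :: "('m, 'n, 'n) cov"
    and c :: "('m, 'n) chart"
  assumes atlas: "smooth_atlas A" and n: "CARD('n) \<ge> 2"
    and N: "N \<in> torsion_free_connections A" and c: "c \<in> A"
begin

private lemma open_chart: "open (cdom c)" by (rule open_cdom[OF atlas c])

lemma is_connection_tangent: "is_connection A tangent N"
  using N by (simp add: torsion_free_connections_def)

lemma christoffel_sym: "z \<in> cdom c \<Longrightarrow> christoffel N c z a b = christoffel N c z b a"
  using N c by (simp add: torsion_free_connections_def)

lemma smooth_in_christoffel: "smooth_in c (cdom c) (\<lambda>z. christoffel N c z a b $ d)"
  using smooth_in_connection_coefficient[OF atlas is_connection_tangent smooth_cocycle_tangent[OF atlas] c, of b a]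
    smooth_in_component[OF atlas c open_chart, of "\<lambda>z. N c (\<lambda>_. axis b 1) z a"]
  unfolding christoffel_def by blast

lemma smooth_in_density_form: "smooth_in c (cdom c) (\<lambda>z. density_form N c z a)"
proof -
  have "smooth_in c (cdom c) (\<lambda>z. (2 / (2 * real CARD('n) + 2)) * (\<Sum>i\<in>UNIV. christoffel N c z a i $ i))"
    by (intro smooth_in_mult[OF atlas c open_chart] smooth_in_const[OF atlas c open_chart] smooth_in_sum[OF atlas c open_chart]
        smooth_in_christoffel finite)
  then show ?thesis by (simp add: density_form_def)
qed

lemma smooth_in_thomas: "smooth_in c (cdom c) (\<lambda>z. thomas N c z a b d)"
  unfolding thomas_def
  by (intro smooth_in_diff[OF atlas c open_chart] smooth_in_mult[OF atlas c open_chart] smooth_in_const[OF atlas c open_chart]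
      smooth_in_christoffel smooth_in_density_form)

lemma thomas_sym: "z \<in> cdom c \<Longrightarrow> thomas N c z a b d = thomas N c z b a d"
  by (simp add: thomas_def christoffel_sym[of z a b])

lemma thomas_trace:
  assumes z: "z \<in> cdom c"
  shows "(\<Sum>i\<in>UNIV. thomas N c z i b i) = 0"
proof -
  have "(\<Sum>i\<in>UNIV. thomas N c z i b i) =
      (\<Sum>i\<in>UNIV. christoffel N c z b i $ i - kron b i * density_form N c z i - density_form N c z b)"
    by (intro sum.cong) (simp_all add: thomas_def christoffel_sym[OF z, of b])
  also have "\<dots> = (\<Sum>i\<in>UNIV. christoffel N c z b i $ i) - (1 + real CARD('n)) * density_form N c z b"
    by (simp only: sum_subtractf sum_kron) (simp add: algebra_simps)
  also have "\<dots> = 0"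
    by (simp add: density_form_def field_simps)
  finally show ?thesis .
qed

lemma pd_thomas_sym:
  assumes x: "x \<in> cdom c"
  shows "pd c e (\<lambda>z. thomas N c z a b d) x = pd c e (\<lambda>z. thomas N c z b a d) x"
  by (rule pd_cong[OF atlas c open_chart]) (use x thomas_sym in auto)

text \<open>The trace of the Thomas symbols is zero on the whole chart, so its derivatives vanish
  too and \<open>ricci_of_symmetric\<close> applies.\<close>

lemma chart_schouten_thomas_sym:
  assumes x: "x \<in> cdom c"
  shows "chart_schouten c (thomas N c) x a b = chart_schouten c (thomas N c) x b a"
proof -
  have "(\<Sum>i\<in>UNIV. pd c a (\<lambda>z. thomas N c z i b i) x) = pd c a (\<lambda>z. \<Sum>i\<in>UNIV. thomas N c z i b i) x" for a b
    by (intro pd_sum[symmetric] smooth_in_differentiable[OF atlas c open_chart _ smooth_in_thomas]) (use x in simp)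
  also have "\<dots> a b = pd c a (\<lambda>_. 0) x" for a b
    by (rule pd_cong[OF atlas c open_chart]) (use x thomas_trace in auto)
  finally have "(\<Sum>i\<in>UNIV. pd c a (\<lambda>z. thomas N c z i b i) x) = 0" for a b by simp
  then have "ricci_of (chart_riemann c (thomas N c) x) a b = ricci_of (chart_riemann c (thomas N c) x) b a" for a b
    unfolding chart_riemann_def
    by (intro ricci_of_symmetric thomas_sym[OF x] pd_thomas_sym[OF x] thomas_trace[OF x])
  then show ?thesis
    by (simp add: chart_schouten_def schouten_of_def)
qed

lemma smooth_in_chart_schouten_thomas: "smooth_in c (cdom c) (\<lambda>z. chart_schouten c (thomas N c) z a b)"
proof -
  have r: "smooth_in c (cdom c) (\<lambda>z. chart_riemann c (thomas N c) z a b i j)" for a b i j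
    unfolding chart_riemann_def riemann_of_def
    by (intro smooth_in_add[OF atlas c open_chart] smooth_in_diff[OF atlas c open_chart] smooth_in_sum[OF atlas c open_chart] finite
      smooth_in_mult[OF atlas c open_chart] smooth_in_thomas smooth_in_pd[OF atlas c open_chart])
  have "smooth_in c (cdom c) (\<lambda>z. (1 / ((real CARD('n))\<^sup>2 - 1)) *
      (real CARD('n) * (\<Sum>i\<in>UNIV. chart_riemann c (thomas N c) z i a i b) + (\<Sum>i\<in>UNIV. chart_riemann c (thomas N c) z i b i a)))"
    by (intro smooth_in_add[OF atlas c open_chart] smooth_in_sum[OF atlas c open_chart] finite
      smooth_in_mult[OF atlas c open_chart] smooth_in_const[OF atlas c open_chart] r)
  then show ?thesis by (simp add: chart_schouten_def schouten_of_def ricci_of_def)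
qed

section \<open>Affine and tractor curvature in a chart\<close>

lemma affine_curvature_in_chart:
  assumes x: "x \<in> cdom c"
  shows "affine_curvature A N c x a b $ i $ j = chart_riemann c (\<lambda>z a b d. christoffel N c z a b $ d) x a b i j"
proof -
  define W :: "'m \<Rightarrow> 'n \<Rightarrow> real^'n^'n" where "W z a = (\<chi> i j. christoffel N c z a j $ i)" for z a
  have "affine_curvature A N c x a b $ i $ j =
      pd c a (\<lambda>z. W z b $ i $ j) x - pd c b (\<lambda>z. W z a $ i $ j) x
      + (\<Sum>l\<in>UNIV. W x a $ i $ l * W x b $ l $ j - W x b $ i $ l * W x a $ l $ j)"
  proof (rule curvature_in_chart[OF atlas smooth_cocycle_tangent[OF atlas] c x])
    fix U and f :: "'m \<Rightarrow> real^'n" and z a assume h: "open U" "U \<subseteq> cdom c" "smooth_in c U f" "z \<in> U"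
    show "N c f z a = pd c a f z + W z a *v f z"
      by (simp add: connection_in_chart[OF atlas is_connection_tangent smooth_cocycle_tangent[OF atlas] c h]
          vec_eq_iff W_def matrix_vector_mult_def christoffel_def mult.commute)
  qed (simp_all add: W_def smooth_in_christoffel christoffel_sym[OF x])
  then show ?thesis by (simp add: W_def chart_riemann_def riemann_of_def)
qed

text \<open>Passing from the Thomas symbols to the Christoffel symbols is formally a projective
  change by the density form. The algebraic formula applies although neither object is a
  tensor.\<close>

lemma affine_curvature_thomas:
  assumes x: "x \<in> cdom c"
  shows "affine_curvature A N c x a b $ i $ j = chart_riemann c (thomas N c) x a b i j
    - kron a i * schouten_shift N c x b j + kron b i * schouten_shift N c x a j
    + (schouten_shift N c x a b - schouten_shift N c x b a) * kron i j"
proof -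
  note df = smooth_in_differentiable[OF atlas c open_chart IntI[OF x x]]
  note sm = smooth_in_add[OF atlas c open_chart] smooth_in_mult[OF atlas c open_chart] smooth_in_const[OF atlas c open_chart]
      smooth_in_thomas smooth_in_density_form
  have G: "christoffel N c z a b $ d = thomas N c z a b d + density_form N c z a * kron b d + density_form N c z b * kron a d" for z a b d
    by (simp add: thomas_def)
  have dG: "pd c e (\<lambda>z. christoffel N c z a b $ d) x = pd c e (\<lambda>z. thomas N c z a b d) x
      + pd c e (\<lambda>z. density_form N c z a) x * kron b d + pd c e (\<lambda>z. density_form N c z b) x * kron a d" for e a b d
  proof -
    have m: "pd c e (\<lambda>z. density_form N c z a * k) x = pd c e (\<lambda>z. density_form N c z a) x * k" for a k
      by (subst pd_mult[OF param_coord[OF atlas c x]]) (intro df sm | simp)+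
    show ?thesis
      unfolding G by (subst pd_add, (intro df sm)+)+ (simp only: m)
  qed
  show ?thesis
    unfolding affine_curvature_in_chart[OF x] schouten_shift_def chart_riemann_def dG
    unfolding G by (rule riemann_of_projective_change) (rule thomas_sym[OF x])
qed

lemma schouten_thomas:
  assumes x: "x \<in> cdom c"
  shows "schouten A N c x a b = chart_schouten c (thomas N c) x a b - schouten_shift N c x a b"
proof -
  have "ricci A N c x = ricci_of (\<lambda>a b i j. affine_curvature A N c x a b $ i $ j)"
    by (simp add: fun_eq_iff ricci_def ricci_of_def)
  then show ?thesis
    unfolding schouten_eq_schouten_of[OF n] chart_schouten_def
    using schouten_of_projective_change[OF n affine_curvature_thomas[OF x]] by simp
qed

text \<open>The weighted derivative contributes the Christoffel symbol and one density term. Its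
  \<open>None\<close> component \<open>- kron e a\<close> produces the other density term on return
  to the jet frame, which completes the Thomas symbol.\<close>

lemma cotractor_cov_axis_Some:
  "cotractor_cov A N c (\<lambda>_. axis (Some e) 1) z a =
     (\<chi> D. case D of None \<Rightarrow> - kron e a | Some b \<Rightarrow> - thomas N c z a b e)"
proof -
  have ax: "(axis e 1 :: real^'n) $ b = kron b e" for b by (simp add: axis_def)
  have s: "split_cotractor N c y (axis (Some e) 1) = (axis e 1, 0)" for y
    by (simp add: split_cotractor_def vec_eq_iff axis_def)
  have d: "dual_cov N c (\<lambda>_. axis e 1) z a $ b = - christoffel N c z a b $ e" for b
    by (simp add: dual_cov_def christoffel_def inner_axis')
  show ?thesis
    unfolding cotractor_cov_def s fst_conv snd_conv Let_def unsplit_cotractor_def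
      weighted_covector_cov_def density_cov_def
    by (auto simp: vec_eq_iff d ax thomas_def split: option.split)
qed

text \<open>In the splitting this frame element is the density form together with 1. The weighted
  derivative of the density form equals \<open>schouten_shift\<close>, which turns the Schouten
  tensor of \<open>N\<close> into that of the Thomas symbols.\<close>

lemma cotractor_cov_axis_None:
  assumes z: "z \<in> cdom c"
  shows "cotractor_cov A N c (\<lambda>_. axis None 1) z a =
     (\<chi> D. case D of None \<Rightarrow> 0 | Some b \<Rightarrow> chart_schouten c (thomas N c) z a b)"
proof -
  have s: "split_cotractor N c y (axis None 1) = ((\<chi> b. density_form N c y b), 1)" for y
    by (simp add: split_cotractor_def vec_eq_iff axis_def)
  have t: "(\<Sum>e\<in>UNIV. thomas N c z a b e * density_form N c z e) =
      (\<Sum>e\<in>UNIV. christoffel N c z a b $ e * density_form N c z e) - 2 * (density_form N c z a * density_form N c z b)" for b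
  proof -
    have "(\<Sum>e\<in>UNIV. thomas N c z a b e * density_form N c z e) =
      (\<Sum>e\<in>UNIV. christoffel N c z a b $ e * density_form N c z e - kron b e * (density_form N c z a * density_form N c z e)
        - kron a e * (density_form N c z b * density_form N c z e))"
      by (intro sum.cong refl) (simp only: thomas_def algebra_simps)
    then show ?thesis by (simp only: sum_subtractf sum_kron) simp
  qed
  have d: "dual_cov N c (\<lambda>y. \<chi> b. density_form N c y b) z a $ b = pd c a (\<lambda>y. density_form N c y b) z
      - (\<Sum>e\<in>UNIV. christoffel N c z a b $ e * density_form N c z e)" for b
    by (simp add: dual_cov_def christoffel_def inner_vec_def mult.commute)
  show ?thesis
    unfolding cotractor_cov_def s fst_conv snd_conv Let_def unsplit_cotractor_def
      weighted_covector_cov_def density_cov_def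
    by (auto simp: vec_eq_iff d schouten_thomas[OF z] schouten_shift_def t split: option.split)
qed

lemma tractor_curvature_in_chart:
  assumes x: "x \<in> cdom c"
  shows "tractor_curvature A N c x a b $ Some i $ Some j =
      chart_riemann c (thomas N c) x a b i j - schouten_wedge (chart_schouten c (thomas N c) x) a b $ i $ j"
    and "tractor_curvature A N c x a b $ k $ None = 0"
proof -
  let ?K = "thomas N c" and ?P = "chart_schouten c (thomas N c)"
  \<comment> \<open>By duality, row \<open>C\<close> of the connection matrix is minus the
    derivative of the \<open>C\<close>-th cotractor frame element.\<close>
  define W :: "'m \<Rightarrow> 'n \<Rightarrow> real^('n option)^('n option)"
    where "W z a = (\<chi> C D. - cotractor_cov A N c (\<lambda>_. axis C 1) z a $ D)" for z a
  have W: "W z a $ Some i $ Some j = ?K z a j i" "W z a $ Some i $ None = kron i a"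
    "W z a $ None $ Some j = - ?P z a j" "W z a $ None $ None = 0" if "z \<in> cdom c" for z a i j
    using that by (simp_all add: W_def cotractor_cov_axis_Some cotractor_cov_axis_None)
  have F: "tractor_curvature A N c x a b $ C $ D =
      pd c a (\<lambda>z. W z b $ C $ D) x - pd c b (\<lambda>z. W z a $ C $ D) x
      + (\<Sum>l\<in>UNIV. W x a $ C $ l * W x b $ l $ D - W x b $ C $ l * W x a $ l $ D)" for C D
  proof (rule curvature_in_chart[OF atlas smooth_cocycle_dual[OF atlas smooth_cocycle_cotractor[OF atlas]] c x])
    show "christoffel N c x a b = christoffel N c x b a" for a b by (rule christoffel_sym[OF x])
    show "smooth_in c (cdom c) (\<lambda>z. W z a $ C $ D)" for a C D
    proof (cases C; cases D)
      fix i j assume "C = Some i" "D = Some j"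
      then show ?thesis by (intro smooth_in_cong[OF atlas c open_chart _ smooth_in_thomas[of a j i]]) (simp add: W)
    next
      fix i assume "C = Some i" "D = None"
      then show ?thesis by (intro smooth_in_cong[OF atlas c open_chart _ smooth_in_const[OF atlas c open_chart, of "kron i a"]]) (simp add: W)
    next
      fix j assume "C = None" "D = Some j"
      then show ?thesis
        by (intro smooth_in_cong[OF atlas c open_chart _ smooth_in_minus[OF atlas c open_chart smooth_in_chart_schouten_thomas[of a j]]]) (simp add: W)
    next
      assume "C = None" "D = None"
      then show ?thesis by (intro smooth_in_cong[OF atlas c open_chart _ smooth_in_const[OF atlas c open_chart, of 0]]) (simp add: W)
    qed
    fix U and f :: "'m \<Rightarrow> real^('n option)" and z a
    assume h: "open U" "U \<subseteq> cdom c" "smooth_in c U f" "z \<in> U"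
    have "(f \<circ> param c) differentiable at (coord c z)"
      by (rule smooth_in_differentiable[OF atlas c h(1) _ h(3)]) (use h in auto)
    then show "tractor_cov A N c f z a = pd c a f z + W z a *v f z"
      by (simp add: tractor_cov_def dual_cov_def vec_eq_iff W_def matrix_vector_mult_def inner_vec_def
          pd_component sum_negf mult.commute)
  qed
  have pdW: "pd c e (\<lambda>z. W z b $ C $ D) x = pd c e g x" if "\<And>z. z \<in> cdom c \<Longrightarrow> W z b $ C $ D = g z" for e b C D g
    by (rule pd_cong[OF atlas c open_chart]) (use x that in auto)
  show "tractor_curvature A N c x a b $ Some i $ Some j =
      chart_riemann c (thomas N c) x a b i j - schouten_wedge (?P x) a b $ i $ j"
    unfolding F sum_UNIV_option
    by (simp add: pdW[OF W(1)] W[OF x] chart_riemann_def riemann_of_def schouten_wedge_def)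
  show "tractor_curvature A N c x a b $ k $ None = 0"
  proof (cases k)
    case None
    \<comment> \<open>The corner entry is the skew part of the Schouten tensor of the Thomas
      symbols, which is symmetric.\<close>
    have "(\<Sum>l\<in>UNIV. kron l a * ?P x b l - kron l b * ?P x a l) = 0"
      using chart_schouten_thomas_sym[OF x, of a b] by (simp only: sum_subtractf sum_kron)
    then show ?thesis
      unfolding None F sum_UNIV_option
      by (simp add: pdW[OF W(4)] W[OF x] mult.commute)
  next
    case (Some i)
    \<comment> \<open>These entries are the torsion of the Thomas symbols.\<close>
    have "(\<Sum>l\<in>UNIV. kron l b * ?K x a l i - kron l a * ?K x b l i) = 0"
      using thomas_sym[OF x, of a b] by (simp only: sum_subtractf sum_kron)
    then show ?thesis
      unfolding Some F sum_UNIV_option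
      by (simp add: pdW[OF W(2)] W[OF x] mult.commute)
  qed
qed

end


text \<open>A projective change by \<Upsilon> adds \<Upsilon> to the density form, and the two
  density terms in \<open>thomas\<close> compensate the change of the Christoffel symbols.\<close>

lemma thomas_projectively_invariant:
  fixes A :: "('m::{t2_space,second_countable_topology}, 'n::finite) chart set"
  assumes atlas: "smooth_atlas A" and rel: "(N, N') \<in> projective_rel A"
    and c: "c \<in> A" and z: "z \<in> cdom c"
  shows "thomas N' c z a b d = thomas N c z a b d"
proof -
  obtain \<Upsilon> where \<Upsilon>: "\<forall>U Y. open U \<and> is_section A tangent U Y \<longrightarrow>
         (\<forall>c\<in>A. \<forall>x\<in>U \<inter> cdom c. \<forall>a b.
            N' c (Y c) x a $ b = N c (Y c) x a $ b + \<Upsilon> c x $ a * Y c x $ b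
              + (\<Sum>e\<in>UNIV. \<Upsilon> c x $ e * Y c x $ e) * (if a = b then 1 else 0))"
    using rel unfolding projective_rel_def by blast
  have o: "open (cdom c)" by (rule open_cdom[OF atlas c])
  have ax: "(axis b 1 :: real^'n) $ d = kron b d" for b d by (simp add: axis_def)
  \<comment> \<open>Projective equivalence is stated for sections, so the coordinate frame field is
    first extended to one.\<close>
  have G: "christoffel N' c z a b $ d = christoffel N c z a b $ d + \<Upsilon> c z $ a * kron b d + \<Upsilon> c z $ b * kron a d" for a b d
  proof -
    obtain Y where Y: "is_section A tangent (cdom c) Y" "Y c = (\<lambda>_. axis b 1)"
      by (rule section_extending_components[OF atlas smooth_cocycle_tangent[OF atlas] c o subset_refl
            smooth_in_const[OF atlas c o]]) blast
    have "N' c (Y c) z a $ d = N c (Y c) z a $ d + \<Upsilon> c z $ a * Y c z $ d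
              + (\<Sum>e\<in>UNIV. \<Upsilon> c z $ e * Y c z $ e) * (if a = d then 1 else 0)"
      using \<Upsilon>[rule_format, OF conjI[OF o Y(1)] c, of z a d] z by simp
    then show ?thesis by (simp only: Y(2) christoffel_def ax sum_kron)
  qed
  have w: "density_form N' c z a = density_form N c z a + \<Upsilon> c z $ a" for a
  proof -
    have "(\<Sum>i\<in>UNIV. christoffel N' c z a i $ i) =
        (\<Sum>i\<in>UNIV. christoffel N c z a i $ i + \<Upsilon> c z $ a + kron a i * \<Upsilon> c z $ i)"
      by (intro sum.cong refl) (simp add: G)
    also have "\<dots> = (\<Sum>i\<in>UNIV. christoffel N c z a i $ i) + (real CARD('n) + 1) * \<Upsilon> c z $ a"
      by (simp only: sum.distrib sum_kron) (simp add: algebra_simps)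
    finally show ?thesis by (simp add: density_form_def field_simps)
  qed
  show ?thesis by (simp only: thomas_def G w) (simp only: algebra_simps)
qed

lemma projective_structure_thomas_unique:
  fixes A :: "('m::{t2_space,second_countable_topology}, 'n::finite) chart set"
  assumes atlas: "smooth_atlas A" and p: "projective_structure A p" and N: "N \<in> p" "N' \<in> p"
  shows "N \<in> torsion_free_connections A" "N' \<in> torsion_free_connections A"
    and "c \<in> A \<Longrightarrow> z \<in> cdom c \<Longrightarrow> thomas N c z a b d = thomas N' c z a b d"
proof -
  obtain N0 where "p = projective_rel A `` {N0}"
    using p by (auto simp: projective_structure_def elim: quotientE)
  then have r: "(N0, N) \<in> projective_rel A" "(N0, N') \<in> projective_rel A" using N by auto
  then show "N \<in> torsion_free_connections A" "N' \<in> torsion_free_connections A"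
    by (auto simp: projective_rel_def)
  show "thomas N c z a b d = thomas N' c z a b d" if "c \<in> A" "z \<in> cdom c"
    using thomas_projectively_invariant[OF atlas r(1) that] thomas_projectively_invariant[OF atlas r(2) that] by metis
qed

theorem proposition4p5:
  fixes A :: "('m::{t2_space,second_countable_topology}, 'n::finite) chart set"
    and p :: "('m, 'n, 'n) cov set"
    and N N' :: "('m, 'n, 'n) cov"
    and k :: nat
  assumes "smooth_atlas A"
    and "CARD('n) \<ge> 2"
    and "projective_structure A p"
    and "N \<in> p"
    and "N' \<in> p" and "scale_connection A N'"
    and "k > 0"
  shows "\<forall>c\<in>A. \<forall>x\<in>cdom c. \<forall>a :: nat \<Rightarrow> 'n. q_form A N k c x a = p_form A N' k c x a"
proof (intro ballI allI)
  fix c x and a :: "nat \<Rightarrow> 'n"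
  assume c: "c \<in> A" and x: "x \<in> cdom c"
  note atlas = assms(1) and n = assms(2)
  note same = projective_structure_thomas_unique[OF atlas assms(3-5)]
  note N = same(1) and N' = same(2)
  let ?R = "chart_riemann c (thomas N' c) x" and ?S = "chart_schouten c (thomas N' c) x"
  let ?P = "schouten A N' c x"
  \<comment> \<open>The Weyl tensor, formed from \<open>N'\<close>. Since the Thomas symbols of
    \<open>N\<close> and \<open>N'\<close> agree on the whole chart, derivatives included, it is
    also the diagonal block of the tractor curvature built from \<open>N\<close>.\<close>
  define W where "W a b = (\<chi> i j. ?R a b i j) - schouten_wedge ?S a b" for a b
  have "pd c e (\<lambda>z. thomas N c z a b d) x = pd c e (\<lambda>z. thomas N' c z a b d) x" for e a b d
    by (rule pd_cong[OF atlas c open_cdom[OF atlas c]]) (use x same(3)[OF c] in auto)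
  moreover have "thomas N c x = thomas N' c x" by (intro ext same(3)[OF c x])
  ultimately have R: "chart_riemann c (thomas N c) x = ?R" by (simp add: chart_riemann_def)
  then have S: "chart_schouten c (thomas N c) x = ?S" by (simp add: chart_schouten_def)
  have "q_form A N k c x a = skew_trace k W a"
    unfolding q_form_def
    by (rule skew_trace_block[OF assms(7)])
       (simp_all add: tractor_curvature_in_chart[OF atlas n N c x] R S W_def)
  also have "\<dots> = skew_trace k (affine_curvature A N' c x) a"
  proof (rule skew_trace_add_wedge[OF assms(7), symmetric])
    show P: "?P a b = ?P b a" for a b using assms(6) c x by (simp add: scale_connection_def)
    have S: "?S a b = ?S b a" for a b by (rule chart_schouten_thomas_sym[OF atlas n N' c x])
    \<comment> \<open>Both tensors on the right are symmetric, the second because \<open>N'\<close>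
      is a scale connection. Hence the \<open>kron i j\<close> term of
      \<open>affine_curvature_thomas\<close> vanishes, and the difference between the curvature and
      \<open>W\<close> is the wedge with \<open>?P\<close>.\<close>
    have shift: "schouten_shift N' c x a b = ?S a b - ?P a b" for a b
      by (simp add: schouten_thomas[OF atlas n N' c x])
    show "affine_curvature A N' c x a b = W a b + schouten_wedge ?P a b" for a b
      by (simp add: vec_eq_iff affine_curvature_thomas[OF atlas n N' c x] shift W_def schouten_wedge_def
          S[of b a] P[of b a])
    show "bianchi W"
      unfolding bianchi_def
    proof (intro allI)
      fix a b i j
      have "?R a b i j + ?R b j i a + ?R j a i b = 0"
        unfolding chart_riemann_def
        by (rule riemann_of_bianchi; rule thomas_sym[OF atlas n N' c x] pd_thomas_sym[OF atlas n N' c x])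
      moreover have "schouten_wedge ?S a b $ i $ j + schouten_wedge ?S b j $ i $ a + schouten_wedge ?S j a $ i $ b = 0"
        using bianchi_schouten_wedge[of ?S, OF S] unfolding bianchi_def by blast
      ultimately show "W a b $ i $ j + W b j $ i $ a + W j a $ i $ b = 0" by (simp add: W_def)
    qed
  qed
  also have "\<dots> = p_form A N' k c x a" by (simp add: p_form_def)
  finally show "q_form A N k c x a = p_form A N' k c x a" .
qed

end
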